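(* Let $\mathcal S$ be a small-step quadrant model whose group $\mathcal G(\mathcal S)$ is finite of order $2n$. Then $H\in\mathbb{Q}(x,y)$ is decoupled if and only if $H_\alpha(x,y)=0$, where $\alpha=\sum_{\gamma\in\mathcal G(\mathcal S)}\operatorname{sign}(\gamma)\gamma$. In this case one can take $F(x)=H_\tau(x,Y_0)+H_\tau(x,Y_1)$ with $\tau=-\frac1n\sum_{i=1}^{n-1}i\,\Theta^i$, and the corresponding $G$ is $G(y)=H_{\tilde\tau}(X_0,y)+H_{\tilde\tau}(X_1,y)+(1-\frac1{2n})J(y)$, where $\tilde\tau=-\frac1n\sum_{i=1}^{n-1}i\,\Theta^{-i}$ and $J(y)=H_\sigma(X_0,y)$ with $\sigma=\sum_{\gamma\in\mathcal G(\mathcal S)}\gamma$.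
   Context: The kernel is $K(x,y)=xy\big(t\sum_{(i,j)\in\mathcal S}w_{i,j}x^iy^j-1\big)=\tilde a(y)x^2+\tilde b(y)x+\tilde c(y)=a(x)y^2+b(x)y+c(x)$ (weights $w_{i,j}$, equal to $1$ in the unweighted case). $Y_0,Y_1$ are the roots of $K(x,y)=0$ in $y$ and $X_0,X_1$ the roots in $x$. The group $\mathcal G(\mathcal S)$ is generated by the involutions $\Phi(u,v)=\big(\frac{\tilde c(v)}{\tilde a(v)}\frac1u,v\big)$ and $\Psi(u,v)=\big(u,\frac{c(u)}{a(u)}\frac1v\big)$; it is dihedral, its elements are the alternating products of $\Phi$ and $\Psi$. Set $\Theta=\Psi\cdot\Phi$ (product in the group). The sign of $\gamma$ is $\operatorname{sign}(\Theta^k)=1$ and $\operatorname{sign}(\Phi\cdot\Theta^k)=-1$. For $A\in\mathbb{Q}(x,y)$ and $\omega=\sum_\gamma c_\gamma\gamma$ in the group algebra, $A_\omega(x,y):=\sum_\gamma c_\gamma A(\gamma(x,y))$. A function $H\in\mathbb{Q}(x,y)$ is decoupled if there exist $F(x)\in\mathbb{Q}(x,t)$ and $G(y)\in\mathbb{Q}(y,t)$ such that $H(x,y)=F(x)+G(y)$ for all pairs $(x,y)$ cancelling the kernel. *)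

theory Defs
  imports
    "HOL-Algebra.Algebraic_Closure_Type"
    "HOL-Algebra.Generated_Groups"
    "HOL-Library.Poly_Mapping"
begin

section \<open>Rational functions in two variables over the rationals\<close>

text \<open>
  The first variable is the inner one, the second variable the outer one.  The same type serves
  for $\mathbb{Q}(x,y)$, $\mathbb{Q}(x,t)$ and $\mathbb{Q}(y,t)$; which variables are meant
  is determined by the pair of values at which a function is evaluated.
\<close>

type_synonym ratfun2 = "rat poly poly fract"

definition var1 :: ratfun2 where
  "var1 = to_fract [:[:0, 1:]:]"

definition var2 :: ratfun2 where
  "var2 = to_fract [:0, 1:]"

definition eval_poly2 :: "rat poly poly \<Rightarrow> 'a::field_char_0 \<Rightarrow> 'a \<Rightarrow> 'a" where
  "eval_poly2 P u v = poly (map_poly (\<lambda>p. poly (map_poly of_rat p) u) P) v"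

definition regular_at :: "ratfun2 \<Rightarrow> 'a::field_char_0 \<Rightarrow> 'a \<Rightarrow> bool" where
  "regular_at A u v \<longleftrightarrow> eval_poly2 (snd (quot_of_fract A)) u v \<noteq> 0"

text \<open>The value is only meaningful where \<open>A\<close> is regular, that is, where the denominator of its
  reduced fraction does not vanish.\<close>

definition eval_ratfun2 :: "ratfun2 \<Rightarrow> 'a::field_char_0 \<Rightarrow> 'a \<Rightarrow> 'a" where
  "eval_ratfun2 A u v =
     eval_poly2 (fst (quot_of_fract A)) u v / eval_poly2 (snd (quot_of_fract A)) u v"


section \<open>Weighted small-step models and their kernel\<close>

text \<open>
  The steps are the elements of \<open>S\<close>; \<open>w\<close> gives their (nonzero rational) weights, and \<open>w s = 1\<close>
  for all \<open>s \<in> S\<close> is the unweighted case.  Steps in each of the four directions are required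
  because otherwise one of $\tilde a$, $\tilde c$, $a$, $c$ is zero and the involutions
  generating the group do not exist.
\<close>

definition small_step_model :: "(int \<times> int) set \<Rightarrow> (int \<times> int \<Rightarrow> rat) \<Rightarrow> bool" where
  "small_step_model S w \<longleftrightarrow>
     S \<subseteq> {-1, 0, 1} \<times> {-1, 0, 1} \<and>
     (\<forall>s\<in>S. w s \<noteq> 0) \<and>
     (\<exists>j. (1, j) \<in> S) \<and> (\<exists>j. (-1, j) \<in> S) \<and>
     (\<exists>i. (i, 1) \<in> S) \<and> (\<exists>i. (i, -1) \<in> S)"

text \<open>The factor $xy$ is multiplied into the sum, which makes all exponents nonnegative.\<close>

definition walk_kernel ::
    "(int \<times> int) set \<Rightarrow> (int \<times> int \<Rightarrow> rat) \<Rightarrow> 'a::field_char_0 \<Rightarrow> 'a \<Rightarrow> 'a \<Rightarrow> 'a" where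
  "walk_kernel S w t x y =
     t * (\<Sum>(i, j)\<in>S. of_rat (w (i, j)) * x ^ nat (i + 1) * y ^ nat (j + 1)) - x * y"

text \<open>
  The kernel is $t\,A_1(y)x^2 + (t\,A_0(y) - y)x + t\,A_{-1}(y)$ where $A_i$ is
  \<open>coeff_x S w i\<close>, so that $\tilde a = t A_1$ and $\tilde c = t A_{-1}$; likewise \<open>coeff_y\<close>
  for $a$ and $c$.
\<close>

definition coeff_x ::
    "(int \<times> int) set \<Rightarrow> (int \<times> int \<Rightarrow> rat) \<Rightarrow> int \<Rightarrow> 'a::field_char_0 \<Rightarrow> 'a" where
  "coeff_x S w i y = (\<Sum>j | (i, j) \<in> S. of_rat (w (i, j)) * y ^ nat (j + 1))"

definition coeff_y ::
    "(int \<times> int) set \<Rightarrow> (int \<times> int \<Rightarrow> rat) \<Rightarrow> int \<Rightarrow> 'a::field_char_0 \<Rightarrow> 'a" where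
  "coeff_y S w j x = (\<Sum>i | (i, j) \<in> S. of_rat (w (i, j)) * x ^ nat (i + 1))"

lemma sum_small_steps:
  fixes f :: "int \<times> int \<Rightarrow> 'a::comm_monoid_add"
  assumes "S \<subseteq> {-1, 0, 1} \<times> {-1, 0, 1}"
  shows "(\<Sum>s\<in>S. f s) = (\<Sum>i\<in>{-1, 0, 1}. \<Sum>j | (i, j) \<in> S. f (i, j))"
    and "(\<Sum>s\<in>S. f s) = (\<Sum>j\<in>{-1, 0, 1}. \<Sum>i | (i, j) \<in> S. f (i, j))"
proof -
  have fin1: "finite {j. (i, j) \<in> S}" for i
    by (rule finite_subset[of _ "{-1, 0, 1}"]) (use assms in auto)
  have fin2: "finite {i. (i, j) \<in> S}" for j
    by (rule finite_subset[of _ "{-1, 0, 1}"]) (use assms in auto)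
  have S1: "S = Sigma {-1, 0, 1} (\<lambda>i. {j. (i, j) \<in> S})"
    using assms by auto
  have S2: "S = prod.swap ` Sigma {-1, 0, 1} (\<lambda>j. {i. (i, j) \<in> S})"
    using assms by (auto simp: image_iff)
  show "(\<Sum>s\<in>S. f s) = (\<Sum>i\<in>{-1, 0, 1}. \<Sum>j | (i, j) \<in> S. f (i, j))"
    by (subst S1, subst sum.Sigma) (use fin1 in \<open>auto simp: case_prod_unfold\<close>)
  show "(\<Sum>s\<in>S. f s) = (\<Sum>j\<in>{-1, 0, 1}. \<Sum>i | (i, j) \<in> S. f (i, j))"
    by (subst S2, subst sum.reindex, simp, subst sum.Sigma)
       (use fin2 in \<open>auto simp: case_prod_unfold prod.swap_def\<close>)
qed

lemma walk_kernel_eq_quadratic: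
  assumes "small_step_model S w"
  shows "walk_kernel S w t x y =
      (t * coeff_x S w 1 y) * x\<^sup>2 + (t * coeff_x S w 0 y - y) * x + t * coeff_x S w (-1) y"
    and "walk_kernel S w t x y =
      (t * coeff_y S w 1 x) * y\<^sup>2 + (t * coeff_y S w 0 x - x) * y + t * coeff_y S w (-1) x"
proof -
  have S: "S \<subseteq> {-1, 0, 1} \<times> {-1, 0, 1}"
    using assms by (simp add: small_step_model_def)
  show "walk_kernel S w t x y =
      (t * coeff_x S w 1 y) * x\<^sup>2 + (t * coeff_x S w 0 y - y) * x + t * coeff_x S w (-1) y"
    unfolding walk_kernel_def sum_small_steps(1)[OF S]
    by (simp add: coeff_x_def sum_distrib_left sum_distrib_right algebra_simps)
  show "walk_kernel S w t x y =
      (t * coeff_y S w 1 x) * y\<^sup>2 + (t * coeff_y S w 0 x - x) * y + t * coeff_y S w (-1) x"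
    unfolding walk_kernel_def sum_small_steps(2)[OF S]
    by (simp add: coeff_y_def sum_distrib_left sum_distrib_right algebra_simps)
qed


section \<open>The group of the model\<close>

text \<open>
  A rational transformation of the plane is given by its two coordinate functions.  The pair is
  dominant when its coordinates are algebraically independent over $\mathbb{Q}$, so that it can
  be substituted into every rational function.  The product is composition of maps:
  $(\gamma\delta)(x,y) = \gamma(\delta(x,y))$.
\<close>

type_synonym ratmap = "ratfun2 \<times> ratfun2"

definition dominant :: "ratmap \<Rightarrow> bool" where
  "dominant \<gamma> \<longleftrightarrow> (\<forall>P. P \<noteq> 0 \<longrightarrow> eval_poly2 P (fst \<gamma>) (snd \<gamma>) \<noteq> 0)"

definition subst_ratfun2 :: "ratfun2 \<Rightarrow> ratmap \<Rightarrow> ratfun2" where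
  "subst_ratfun2 A \<gamma> = eval_ratfun2 A (fst \<gamma>) (snd \<gamma>)"

definition ratmap_monoid :: "ratmap monoid" where
  "ratmap_monoid =
     \<lparr>carrier = {\<gamma>. dominant \<gamma>},
      monoid.mult = (\<lambda>\<gamma> \<delta>. (subst_ratfun2 (fst \<gamma>) \<delta>, subst_ratfun2 (snd \<gamma>) \<delta>)),
      monoid.one = (var1, var2)\<rparr>"

definition birational_group :: "ratmap monoid" where
  "birational_group = units_of ratmap_monoid"

text \<open>The factor \<open>t\<close> cancels in $\tilde c/\tilde a$ and in $c/a$.\<close>

definition step_Phi :: "(int \<times> int) set \<Rightarrow> (int \<times> int \<Rightarrow> rat) \<Rightarrow> ratmap" where
  "step_Phi S w = (coeff_x S w (-1) var2 / coeff_x S w 1 var2 * (1 / var1), var2)"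

definition step_Psi :: "(int \<times> int) set \<Rightarrow> (int \<times> int \<Rightarrow> rat) \<Rightarrow> ratmap" where
  "step_Psi S w = (var1, coeff_y S w (-1) var1 / coeff_y S w 1 var1 * (1 / var2))"

definition step_group :: "(int \<times> int) set \<Rightarrow> (int \<times> int \<Rightarrow> rat) \<Rightarrow> ratmap monoid" where
  "step_group S w = subgroup_generated birational_group {step_Phi S w, step_Psi S w}"

definition Theta :: "(int \<times> int) set \<Rightarrow> (int \<times> int \<Rightarrow> rat) \<Rightarrow> ratmap" where
  "Theta S w = step_Psi S w \<otimes>\<^bsub>step_group S w\<^esub> step_Phi S w"

text \<open>Every element of the group is a power of \<open>Theta\<close> or \<open>step_Phi\<close> times such a power; the
  two cases exclude each other.\<close>

definition group_sign :: "(int \<times> int) set \<Rightarrow> (int \<times> int \<Rightarrow> rat) \<Rightarrow> ratmap \<Rightarrow> rat" where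
  "group_sign S w \<gamma> = (if \<exists>k::int. \<gamma> = Theta S w [^]\<^bsub>step_group S w\<^esub> k then 1 else - 1)"

text \<open>Elements of the group algebra are finitely supported rational-valued functions on the
  group; \<open>group_act A \<omega>\<close> is $A_\omega$.\<close>

definition group_act :: "ratfun2 \<Rightarrow> (ratmap \<Rightarrow>\<^sub>0 rat) \<Rightarrow> ratfun2" where
  "group_act A \<omega> =
     (\<Sum>\<gamma>\<in>Poly_Mapping.keys \<omega>. of_rat (Poly_Mapping.lookup \<omega> \<gamma>) * subst_ratfun2 A \<gamma>)"

definition alpha_elt :: "(int \<times> int) set \<Rightarrow> (int \<times> int \<Rightarrow> rat) \<Rightarrow> ratmap \<Rightarrow>\<^sub>0 rat" where
  "alpha_elt S w =
     (\<Sum>\<gamma>\<in>carrier (step_group S w). Poly_Mapping.single \<gamma> (group_sign S w \<gamma>))"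

definition sigma_elt :: "(int \<times> int) set \<Rightarrow> (int \<times> int \<Rightarrow> rat) \<Rightarrow> ratmap \<Rightarrow>\<^sub>0 rat" where
  "sigma_elt S w = (\<Sum>\<gamma>\<in>carrier (step_group S w). Poly_Mapping.single \<gamma> 1)"

definition tau_elt :: "(int \<times> int) set \<Rightarrow> (int \<times> int \<Rightarrow> rat) \<Rightarrow> nat \<Rightarrow> ratmap \<Rightarrow>\<^sub>0 rat" where
  "tau_elt S w n =
     (\<Sum>i\<in>{1..<n}. Poly_Mapping.single (Theta S w [^]\<^bsub>step_group S w\<^esub> int i)
        (- (1 / of_nat n) * of_nat i))"

definition tau_tilde_elt :: "(int \<times> int) set \<Rightarrow> (int \<times> int \<Rightarrow> rat) \<Rightarrow> nat \<Rightarrow> ratmap \<Rightarrow>\<^sub>0 rat" where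
  "tau_tilde_elt S w n =
     (\<Sum>i\<in>{1..<n}. Poly_Mapping.single (Theta S w [^]\<^bsub>step_group S w\<^esub> (- int i))
        (- (1 / of_nat n) * of_nat i))"


section \<open>Decoupling on the kernel curve\<close>

text \<open>
  The kernel curve is considered over an algebraic closure of $\mathbb{Q}(z,t)$ with two
  indeterminates: \<open>ind_t\<close> is the variable \<open>t\<close> of the kernel, while \<open>ind_z\<close> plays the part of
  the indeterminate \<open>x\<close> when $Y_0, Y_1$ are considered, and of the indeterminate \<open>y\<close> when
  $X_0, X_1$ are considered.
\<close>

type_synonym curve_field = "ratfun2 alg_closure"

definition ind_z :: curve_field where
  "ind_z = to_ac var1"

definition ind_t :: curve_field where
  "ind_t = to_ac var2"

text \<open>
  $H(x,y)=F(x)+G(y)$ is required at all points of the curve at which the three functions are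
  defined.  These include the generic points $(x,Y_0)$ and $(x,Y_1)$ with \<open>x\<close> an indeterminate.
\<close>

definition decoupled_by ::
    "(int \<times> int) set \<Rightarrow> (int \<times> int \<Rightarrow> rat) \<Rightarrow> ratfun2 \<Rightarrow> ratfun2 \<Rightarrow> ratfun2 \<Rightarrow> bool" where
  "decoupled_by S w H F G \<longleftrightarrow>
     (\<forall>x y :: curve_field.
        walk_kernel S w ind_t x y = 0 \<longrightarrow>
        regular_at H x y \<longrightarrow> regular_at F x ind_t \<longrightarrow> regular_at G y ind_t \<longrightarrow>
        eval_ratfun2 H x y = eval_ratfun2 F x ind_t + eval_ratfun2 G y ind_t)"

definition decoupled :: "(int \<times> int) set \<Rightarrow> (int \<times> int \<Rightarrow> rat) \<Rightarrow> ratfun2 \<Rightarrow> bool" where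
  "decoupled S w H \<longleftrightarrow> (\<exists>F G. decoupled_by S w H F G)"

text \<open>For the kernel, a polynomial of degree two in either variable, these predicates say that
  the two values are its roots with multiplicity.\<close>

definition y_roots ::
    "(int \<times> int) set \<Rightarrow> (int \<times> int \<Rightarrow> rat) \<Rightarrow> curve_field \<Rightarrow> curve_field \<Rightarrow> curve_field \<Rightarrow> bool" where
  "y_roots S w x Y0 Y1 \<longleftrightarrow> {y. walk_kernel S w ind_t x y = 0} = {Y0, Y1}"

definition x_roots ::
    "(int \<times> int) set \<Rightarrow> (int \<times> int \<Rightarrow> rat) \<Rightarrow> curve_field \<Rightarrow> curve_field \<Rightarrow> curve_field \<Rightarrow> bool" where
  "x_roots S w y X0 X1 \<longleftrightarrow> {x. walk_kernel S w ind_t x y = 0} = {X0, X1}"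

end

theory Submission
  imports Defs
begin

text \<open>
  Since the kernel is linear in \<open>t\<close>, its generic curve has function field \<open>\<rat>(x, y)\<close>, with \<open>t\<close> the
  rational function \<open>T = xy / \<Sum> w\<^sub>i\<^sub>j x\<^sup>i\<^sup>+\<^sup>1 y\<^sup>j\<^sup>+\<^sup>1\<close>, which the group leaves invariant.  If
  \<open>H = F + G\<close> on the curve, then in \<open>H\<^sub>\<alpha>\<close> the terms in \<open>F\<close> cancel in pairs \<open>\<gamma>, \<Psi>\<gamma>\<close> and the terms
  in \<open>G\<close> in pairs \<open>\<gamma>, \<Phi>\<gamma>\<close>.  Conversely \<open>\<tau> + \<tau>\<Psi> + \<tau>' + \<tau>'\<Phi> + (1 - 1/(2n)) \<sigma> = 1 - \<alpha>/(2n)\<close> in the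
  group algebra, where \<open>\<tau>'\<close> is \<open>\<tau>\<close> with \<open>\<Theta>\<close> inverted; the first two terms applied to \<open>H\<close> are the
  trace over \<open>Y\<^sub>0, Y\<^sub>1\<close>, hence a function of \<open>x\<close> and \<open>t\<close>, and the others are a function of \<open>y\<close> and
  \<open>t\<close>.  The resulting identity in \<open>\<rat>(x, y)\<close> specializes to every point of the curve by Gauss's
  lemma, because the kernel is primitive as a polynomial in \<open>t\<close>.
\<close>

section \<open>Evaluation homomorphisms\<close>

text \<open>Evaluations at points of different fields, substitutions and field embeddings all
  satisfy these laws, so one set of transfer rules serves them all.\<close>

locale ring_morphism =
  fixes h :: "'a::comm_ring_1 \<Rightarrow> 'b::comm_ring_1"
  assumes one [simp]: "h 1 = 1"
    and add: "h (x + y) = h x + h y"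
    and mult: "h (x * y) = h x * h y"
begin

lemma zero [simp]: "h 0 = 0"
  using add[of 0 0] by simp

lemma uminus: "h (- x) = - h x"
  using add[of x "- x"] by (simp add: eq_neg_iff_add_eq_0 add.commute)

lemma diff: "h (x - y) = h x - h y"
  using add[of x "- y"] by (simp add: uminus)

lemma power: "h (x ^ n) = h x ^ n"
  by (induction n) (simp_all add: mult)

lemma sum: "h (sum f A) = (\<Sum>x\<in>A. h (f x))"
  by (induction A rule: infinite_finite_induct) (simp_all add: add)

lemma of_nat: "h (of_nat n) = of_nat n"
  by (induction n) (simp_all add: add)

lemma of_int: "h (of_int n) = of_int n"
  by (cases n rule: int_cases2) (simp_all add: of_nat uminus)

lemma map_poly_pCons: "map_poly h (pCons a p) = pCons (h a) (map_poly h p)"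
  by (rule poly_eqI) (auto simp: coeff_map_poly coeff_pCons split: nat.splits)

lemma map_poly_add: "map_poly h (p + q) = map_poly h p + map_poly h q"
  by (rule poly_eqI) (simp add: coeff_map_poly add)

lemma map_poly_mult: "map_poly h (p * q) = map_poly h p * map_poly h q"
  by (rule poly_eqI) (simp add: coeff_map_poly coeff_mult sum mult)

lemma poly: "h (poly p x) = poly (map_poly h p) (h x)"
  by (induction p) (simp_all add: map_poly_pCons add mult)

text \<open>Iterating this rule makes evaluation of nested polynomials a morphism: from
  \<open>rat\<close> to one variable, then to two, and later to three.\<close>

lemma ring_morphism_poly: "ring_morphism (\<lambda>p. poly (map_poly h p) x)"
  by unfold_locales (simp_all add: map_poly_add map_poly_mult)

end

lemma ring_morphism_of_rat: "ring_morphism (of_rat :: rat \<Rightarrow> 'a::field_char_0)"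
  by unfold_locales (simp_all add: of_rat_add of_rat_mult)

lemma ring_morphism_eval_poly1:
  "ring_morphism (\<lambda>p. poly (map_poly of_rat p) (u :: 'a::field_char_0))"
  by (rule ring_morphism.ring_morphism_poly[OF ring_morphism_of_rat])

lemma ring_morphism_eval_poly2: "ring_morphism (\<lambda>P. eval_poly2 P (u :: 'a::field_char_0) v)"
  unfolding eval_poly2_def
  by (rule ring_morphism.ring_morphism_poly[OF ring_morphism_eval_poly1])

lemma eval_poly2_const: "eval_poly2 [:p:] u v = poly (map_poly of_rat p) u"
  by (simp add: eval_poly2_def ring_morphism.map_poly_pCons[OF ring_morphism_eval_poly1])

lemma eval_poly2_X [simp]: "eval_poly2 [:[:0, 1:]:] u v = u"
  by (simp add: eval_poly2_const ring_morphism.map_poly_pCons[OF ring_morphism_of_rat])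

lemma eval_poly2_Y [simp]: "eval_poly2 [:0, 1:] u v = v"
  by (simp add: eval_poly2_def ring_morphism.map_poly_pCons[OF ring_morphism_eval_poly1])

lemma eval_poly2_of_rat [simp]: "eval_poly2 [:[:c:]:] u v = of_rat c"
  by (simp add: eval_poly2_const ring_morphism.map_poly_pCons[OF ring_morphism_of_rat])

lemma eval_poly2_map_const:
  "eval_poly2 (map_poly (\<lambda>c. [:c:]) p) u v = poly (map_poly of_rat p) v"
  unfolding eval_poly2_def
  by (subst map_poly_map_poly)
     (auto simp: comp_def ring_morphism.map_poly_pCons[OF ring_morphism_of_rat])

lemma eval_poly2_0 [simp]: "eval_poly2 0 u v = 0"
  and eval_poly2_1 [simp]: "eval_poly2 1 u v = 1"
  by (simp_all add: eval_poly2_def)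

lemmas eval_poly2_simps =
  ring_morphism.add[OF ring_morphism_eval_poly2] ring_morphism.mult[OF ring_morphism_eval_poly2]
  ring_morphism.diff[OF ring_morphism_eval_poly2] ring_morphism.power[OF ring_morphism_eval_poly2]
  ring_morphism.uminus[OF ring_morphism_eval_poly2] ring_morphism.sum[OF ring_morphism_eval_poly2]

locale field_morphism = ring_morphism h for h :: "'a::field_char_0 \<Rightarrow> 'b::field_char_0"
begin

lemma eq_0_iff [simp]: "h x = 0 \<longleftrightarrow> x = 0"
proof
  assume "h x = 0"
  show "x = 0"
  proof (rule ccontr)
    assume "x \<noteq> 0"
    then have "h 1 = h x * h (inverse x)" by (simp flip: mult)
    with \<open>h x = 0\<close> show False by simp
  qed
qed simp

lemma eq_iff: "h x = h y \<longleftrightarrow> x = y"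
  using eq_0_iff[of "x - y"] by (simp add: diff)

lemma inverse: "h (inverse x) = inverse (h x)"
proof (cases "x = 0")
  case False
  then have "h x * h (inverse x) = 1" by (simp flip: mult)
  then show ?thesis by (metis inverse_unique)
qed simp

lemma divide: "h (x / y) = h x / h y"
  by (simp add: divide_inverse mult inverse)

lemma of_rat: "h (of_rat q) = of_rat q"
  by (cases q) (simp add: of_rat_rat divide of_int)

text \<open>The coefficients are rational, and a field morphism in characteristic 0 fixes the
  rationals; so only the point moves.\<close>

lemma eval_poly2: "h (eval_poly2 P u v) = eval_poly2 P (h u) (h v)"
proof -
  have "h (poly (map_poly of_rat p) u) = poly (map_poly of_rat p) (h u)" for p
    by (simp add: poly map_poly_map_poly comp_def of_rat)
  then show ?thesis
    by (simp add: eval_poly2_def poly map_poly_map_poly comp_def)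
qed

lemma eval_ratfun2: "h (eval_ratfun2 A u v) = eval_ratfun2 A (h u) (h v)"
  by (simp add: eval_ratfun2_def divide eval_poly2)

lemma walk_kernel: "h (walk_kernel S w t x y) = walk_kernel S w (h t) (h x) (h y)"
  by (simp add: walk_kernel_def diff mult sum case_prod_unfold of_rat power)

lemma coeff_x: "h (coeff_x S w i y) = coeff_x S w i (h y)"
  by (simp add: coeff_x_def sum mult of_rat power)

lemma coeff_y: "h (coeff_y S w i y) = coeff_y S w i (h y)"
  by (simp add: coeff_y_def sum mult of_rat power)

end

section \<open>Rational functions at algebraically independent points\<close>

text \<open>Algebraic independence over the rationals, in any field: the pair is then a generic
  point, at which no nonzero denominator vanishes.\<close>

definition indep :: "'a::field_char_0 \<Rightarrow> 'a \<Rightarrow> bool" where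
  "indep u v \<longleftrightarrow> (\<forall>P. P \<noteq> 0 \<longrightarrow> eval_poly2 P u v \<noteq> 0)"

lemma indepD: "indep u v \<Longrightarrow> eval_poly2 P u v = 0 \<longleftrightarrow> P = 0"
  by (auto simp: indep_def)

lemma dominant_iff: "dominant \<gamma> \<longleftrightarrow> indep (fst \<gamma>) (snd \<gamma>)"
  by (simp add: dominant_def indep_def)

lemma indep_nonzero:
  assumes "indep u v"
  shows "u \<noteq> 0" "v \<noteq> 0"
  using indepD[OF assms, of "[:[:0, 1:]:]"] indepD[OF assms, of "[:0, 1:]"] by auto

lemma indep_regular: "indep u v \<Longrightarrow> regular_at A u v"
  by (simp add: regular_at_def indepD)

text \<open>\<open>eval_ratfun2\<close> is tied to the reduced fraction. Cross-multiplying two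
  representations gives a polynomial identity, and at an independent point it can be evaluated and
  divided back.\<close>

lemma eval_ratfun2_fraction:
  assumes "indep u v" "Q \<noteq> 0"
  shows "eval_ratfun2 (to_fract P / to_fract Q) u v = eval_poly2 P u v / eval_poly2 Q u v"
proof -
  define A where "A = to_fract P / to_fract Q"
  obtain N D where ND: "quot_of_fract A = (N, D)" by (cases "quot_of_fract A")
  have D: "D \<noteq> 0" using snd_quot_of_fract_nonzero[of A] ND by simp
  have "A = to_fract N / to_fract D"
    using Fract_quot_of_fract[of A] ND by (simp add: Fract_conv_to_fract)
  then have "to_fract P * to_fract D = to_fract N * to_fract Q"
    using D assms(2) unfolding A_def by (simp add: field_simps)
  then have "P * D = N * Q"
    by (simp flip: to_fract_mult)
  then have "eval_poly2 P u v * eval_poly2 D u v = eval_poly2 N u v * eval_poly2 Q u v"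
    by (metis eval_poly2_simps(2))
  then show ?thesis
    using D assms unfolding A_def[symmetric] eval_ratfun2_def ND
    by (simp add: field_simps indepD)
qed

lemma ratfun2_cases:
  obtains P Q where "A = to_fract P / to_fract Q" "Q \<noteq> (0 :: rat poly poly)"
  by (metis Fract_quot_of_fract Fract_conv_to_fract snd_quot_of_fract_nonzero)

lemma eval_ratfun2_to_fract [simp]: "eval_ratfun2 (to_fract P) u v = eval_poly2 P u v"
  by (simp add: eval_ratfun2_def)

lemma eval_var1 [simp]: "eval_ratfun2 var1 u v = u"
  and eval_var2 [simp]: "eval_ratfun2 var2 u v = v"
  by (simp_all add: var1_def var2_def)

lemma field_morphism_eval_ratfun2:
  assumes "indep u v"
  shows "field_morphism (\<lambda>A. eval_ratfun2 A u v)"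
proof
  show "eval_ratfun2 1 u v = 1"
    using eval_ratfun2_to_fract[of 1 u v] by simp
next
  fix A B :: ratfun2
  obtain P Q where A: "A = to_fract P / to_fract Q" "Q \<noteq> 0" by (rule ratfun2_cases)
  obtain R T where B: "B = to_fract R / to_fract T" "T \<noteq> 0" by (rule ratfun2_cases)
  have AB: "A + B = to_fract (P * T + R * Q) / to_fract (Q * T)"
    "A * B = to_fract (P * R) / to_fract (Q * T)"
    using A B by (simp_all add: field_simps)
  show "eval_ratfun2 (A + B) u v = eval_ratfun2 A u v + eval_ratfun2 B u v"
    using assms A(2) B(2) unfolding AB unfolding A B
    by (simp del: to_fract_add to_fract_mult
          add: eval_ratfun2_fraction eval_poly2_simps indepD field_simps)
  show "eval_ratfun2 (A * B) u v = eval_ratfun2 A u v * eval_ratfun2 B u v"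
    using assms A(2) B(2) unfolding AB unfolding A B
    by (simp del: to_fract_mult add: eval_ratfun2_fraction eval_poly2_simps)
qed

lemma field_morphism_to_ac: "field_morphism (to_ac :: 'a::field_char_0 \<Rightarrow> 'a alg_closure)"
  by unfold_locales simp_all

lemma eval_poly2_var [simp]: "eval_poly2 P var1 var2 = to_fract P"
proof -
  have tf: "ring_morphism (to_fract :: rat poly poly \<Rightarrow> ratfun2)"
    by unfold_locales simp_all
  \<comment> \<open>The nested constant polynomial and \<open>of_rat\<close> are two embeddings of
    the rationals; they agree on integers, hence on quotients.\<close>
  have rat: "to_fract [:[:c:]:] = (of_rat c :: ratfun2)" for c
  proof (cases c)
    case (Fract a b)
    have "to_fract [:[:of_int a:]:] = (of_int a :: ratfun2)"
      using ring_morphism.of_int[OF tf, of a] by (simp add: of_int_poly)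
    moreover have "to_fract [:[:of_int b:]:] = (of_int b :: ratfun2)"
      using ring_morphism.of_int[OF tf, of b] by (simp add: of_int_poly)
    moreover have "of_int b * c = of_int a"
      using Fract by (simp add: Fract_of_int_quotient)
    then have "to_fract [:[:of_int b:]:] * to_fract [:[:c:]:] = (to_fract [:[:of_int a:]:] :: ratfun2)"
      by (simp flip: to_fract_mult)
    ultimately show ?thesis
      using Fract by (simp add: of_rat_rat field_simps)
  qed
  have "poly (map_poly of_rat p) var1 = (to_fract [:p:] :: ratfun2)" for p
  proof (induction p)
    case (pCons a p)
    have "[:pCons a p:] = [:[:a:]:] + [:[:0, 1:]:] * [:p:]" by simp
    then have "(to_fract [:pCons a p:] :: ratfun2) = to_fract [:[:a:]:] + var1 * to_fract [:p:]"
      unfolding var1_def by (metis to_fract_add to_fract_mult)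
    with pCons show ?case
      by (simp add: rat ring_morphism.map_poly_pCons[OF ring_morphism_of_rat])
  qed simp
  then have ev1: "(\<lambda>p. poly (map_poly of_rat p) (var1 :: ratfun2)) = (\<lambda>p. to_fract [:p:])"
    by auto
  have morph: "ring_morphism (\<lambda>p :: rat poly. to_fract [:p:])"
    using ring_morphism_eval_poly1[of "var1 :: ratfun2"] unfolding ev1 .
  show ?thesis
    unfolding eval_poly2_def ev1
  proof (induction P)
    case (pCons a p)
    have "pCons a p = [:a:] + [:0, 1:] * p" by simp
    then have "(to_fract (pCons a p) :: ratfun2) = to_fract [:a:] + var2 * to_fract p"
      unfolding var2_def by (metis to_fract_add to_fract_mult)
    with pCons show ?case
      by (simp add: ring_morphism.map_poly_pCons[OF morph])
  qed simp
qed

lemma indep_var: "indep var1 var2"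
  by (simp add: indep_def)

lemma eval_ratfun2_var [simp]: "eval_ratfun2 A var1 var2 = A"
  by (rule ratfun2_cases[of A]) (simp add: eval_ratfun2_fraction indep_var)

lemma indep_ind: "indep ind_z ind_t"
  unfolding indep_def ind_z_def ind_t_def
  by (simp flip: field_morphism.eval_poly2[OF field_morphism_to_ac])

lemma eval_ratfun2_ind: "eval_ratfun2 A ind_z ind_t = to_ac A"
  unfolding ind_z_def ind_t_def
  by (simp flip: field_morphism.eval_ratfun2[OF field_morphism_to_ac])

lemma field_morphism_indep_iff:
  assumes "field_morphism h"
  shows "indep (h u) (h v) \<longleftrightarrow> indep u v"
  using field_morphism.eval_poly2[OF assms] field_morphism.eq_0_iff[OF assms]
  unfolding indep_def by metis

section \<open>Algebraic independence\<close>

text \<open>Exchanges the two variables: each coefficient becomes a polynomial in the outer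
  variable, and the inner variable is then inserted for the old outer one.\<close>

definition swap_poly2 :: "rat poly poly \<Rightarrow> rat poly poly" where
  "swap_poly2 P = poly (map_poly (map_poly (\<lambda>c. [:c:])) P) [:[:0, 1:]:]"

lemma eval_swap_poly2: "eval_poly2 (swap_poly2 P) v u = eval_poly2 P u v"
  unfolding swap_poly2_def
  by (simp add: eval_poly2_map_const ring_morphism.poly[OF ring_morphism_eval_poly2] map_poly_map_poly comp_def)
     (simp add: eval_poly2_def)

lemma indep_swap: "indep u v \<Longrightarrow> indep v u"
proof (unfold indep_def, intro allI impI)
  fix P :: "rat poly poly" assume uv: "\<forall>P. P \<noteq> 0 \<longrightarrow> eval_poly2 P u v \<noteq> 0" and P: "P \<noteq> 0"
  have "swap_poly2 P \<noteq> 0"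
  proof
    assume "swap_poly2 P = 0"
    then have "eval_poly2 P var1 var2 = 0"
      using eval_swap_poly2[of P var2 var1] by simp
    with P show False by simp
  qed
  with uv show "eval_poly2 P v u \<noteq> 0"
    using eval_swap_poly2[of P u v] by metis
qed

text \<open>Fraction-free Gaussian elimination, since the scalars form only a domain: a pivot row
  \<open>k\<close> clears coordinate \<open>j\<close> from the other rows, which then have one
  coordinate fewer.\<close>

lemma linear_dependence:
  fixes v :: "'i \<Rightarrow> 'j \<Rightarrow> 'a::idom"
  assumes "finite J" "finite I" "card J < card I"
  shows "\<exists>c. (\<exists>i\<in>I. c i \<noteq> 0) \<and> (\<forall>j\<in>J. (\<Sum>i\<in>I. c i * v i j) = 0)"
  using assms
proof (induction J arbitrary: I v rule: finite_induct)
  case empty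
  then have "I \<noteq> {}" by auto
  then show ?case by (auto intro!: exI[of _ "\<lambda>_. 1"])
next
  case (insert j J)
  show ?case
  proof (cases "\<forall>i\<in>I. v i j = 0")
    case True
    have "card J < card I"
      using insert.prems insert.hyps by simp
    from insert.IH[OF insert.prems(1) this, of v] obtain c i where
      "i \<in> I" "c i \<noteq> 0" "\<forall>l\<in>J. (\<Sum>i\<in>I. c i * v i l) = 0"
      by blast
    moreover from True have "(\<Sum>i\<in>I. c i * v i j) = 0" by simp
    ultimately show ?thesis by blast
  next
    case False
    then obtain k where k: "k \<in> I" "v k j \<noteq> 0" by auto
    define w where "w = (\<lambda>i l. v k j * v i l - v i j * v k l)"
    have "finite (I - {k})" "card J < card (I - {k})"
      using insert.prems insert.hyps k by simp_all
    from insert.IH[OF this, of w] obtain c i where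
      c: "i \<in> I" "i \<noteq> k" "c i \<noteq> 0" "\<forall>l\<in>J. (\<Sum>i\<in>I - {k}. c i * w i l) = 0"
      by blast
    \<comment> \<open>The pivot coefficient is chosen so that combining the rows of \<open>v\<close>
      by \<open>c'\<close> equals combining the eliminated rows \<open>w\<close> by
      \<open>c\<close>.\<close>
    define c' where "c' = (\<lambda>i. if i = k then - (\<Sum>i\<in>I - {k}. c i * v i j) else v k j * c i)"
    have sum: "(\<Sum>i\<in>I. c' i * v i l) = (\<Sum>i\<in>I - {k}. c i * w i l)" for l
    proof -
      have "(\<Sum>i\<in>I. c' i * v i l) = c' k * v k l + (\<Sum>i\<in>I - {k}. c' i * v i l)"
        using k insert.prems(1) by (simp add: sum.remove)
      also have "(\<Sum>i\<in>I - {k}. c' i * v i l) = (\<Sum>i\<in>I - {k}. v k j * c i * v i l)"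
        by (rule sum.cong) (auto simp: c'_def)
      also have "c' k * v k l = (\<Sum>i\<in>I - {k}. - c i * v i j * v k l)"
        by (simp add: c'_def sum_distrib_right sum_negf)
      finally show ?thesis
        by (simp add: w_def algebra_simps sum.distrib sum_subtractf sum_negf)
    qed
    have "(\<Sum>i\<in>I. c' i * v i l) = 0" if "l \<in> insert j J" for l
      using that c(4) by (auto simp: sum) (simp add: w_def)
    moreover have "c' i \<noteq> 0" using c k by (simp add: c'_def)
    ultimately show ?thesis using c(1) by blast
  qed
qed

text \<open>With \<open>d = degree f\<close>, the \<open>d + 1\<close> polynomials \<open>N\<^sup>i D\<^sup>d\<^sup>-\<^sup>i\<close> are linearly dependent modulo \<open>f\<close>.\<close>

lemma algebraic_fraction:
  fixes g :: "'a::idom \<Rightarrow> 'b::field"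
  assumes "ring_morphism g" and inj: "\<And>x. g x = 0 \<Longrightarrow> x = 0"
    and f: "f \<noteq> 0" "poly (map_poly g f) y = 0"
    and D: "poly (map_poly g D) y \<noteq> 0" and t: "t * poly (map_poly g D) y = poly (map_poly g N) y"
  shows "\<exists>c. c \<noteq> 0 \<and> poly (map_poly g c) t = 0"
proof -
  interpret g: ring_morphism g by fact
  interpret ev: ring_morphism "\<lambda>p. poly (map_poly g p) y" by (rule g.ring_morphism_poly)
  define d where "d = degree f"
  define E where "E = (\<lambda>i. N ^ i * D ^ (d - i))"
  define r where "r = (\<lambda>i. pseudo_mod (E i) f)"
  \<comment> \<open>Coefficients cannot be inverted, so reduction modulo \<open>f\<close> is
    pseudo-division, which costs the nonzero factor \<open>a\<close>.\<close>
  have "\<exists>a q. a \<noteq> 0 \<and> smult a (E i) = f * q + r i" for i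
    unfolding r_def by (rule pseudo_mod(1)[OF f(1)])
  then obtain a q where aq: "\<And>i. a i \<noteq> 0" "\<And>i. smult (a i) (E i) = f * q i + r i"
    by metis
  have r: "coeff (r i) j = 0" if "j \<ge> d" for i j
    using pseudo_mod(2)[OF f(1), of "E i"] that unfolding r_def d_def
    by (auto intro: coeff_eq_0)
  \<comment> \<open>There are \<open>d + 1\<close> remainders, each with at most \<open>d\<close>
    nonzero coefficients.\<close>
  obtain c k where c: "k \<le> d" "c k \<noteq> 0" "\<And>j. j < d \<Longrightarrow> (\<Sum>i\<le>d. c i * coeff (r i) j) = 0"
    using linear_dependence[of "{..<d}" "{..d}" "\<lambda>i j. coeff (r i) j"] by auto
  have "(\<Sum>i\<le>d. smult (c i) (r i)) = 0"
  proof (rule poly_eqI)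
    fix j
    show "coeff (\<Sum>i\<le>d. smult (c i) (r i)) j = coeff 0 j"
      using c(3)[of j] r[of j] by (cases "j < d") (simp_all add: coeff_sum)
  qed
  then have "poly (map_poly g (\<Sum>i\<le>d. smult (c i) (r i))) y = 0" by simp
  moreover have smult: "poly (map_poly g (smult b p)) y = g b * poly (map_poly g p) y" for b p
    by (simp add: map_poly_smult g.mult)
  ultimately have "(\<Sum>i\<le>d. g (c i) * poly (map_poly g (r i)) y) = 0"
    by (simp add: ev.sum)
  \<comment> \<open>At the root \<open>y\<close> of \<open>f\<close> the remainder equals the scaled
    \<open>E i\<close>. Homogeneity of degree \<open>d\<close> in \<open>N\<close> and
    \<open>D\<close> leaves a power of \<open>t\<close> times a factor that does not depend on
    \<open>i\<close> and cancels below.\<close>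
  moreover have "poly (map_poly g (r i)) y = g (a i) * t ^ i * poly (map_poly g D) y ^ d"
    if "i \<le> d" for i
  proof -
    have "g (a i) * poly (map_poly g (E i)) y = poly (map_poly g (r i)) y"
      using arg_cong[OF aq(2)[of i], of "\<lambda>p. poly (map_poly g p) y"] f(2)
      by (simp add: smult ev.add ev.mult)
    moreover have "poly (map_poly g (E i)) y = t ^ i * poly (map_poly g D) y ^ d"
      unfolding E_def using that
      by (simp add: ev.mult ev.power t[symmetric] power_mult_distrib flip: power_add)
    ultimately show ?thesis by (simp add: mult.assoc)
  qed
  ultimately have "(\<Sum>i\<le>d. g (c i * a i) * t ^ i) * poly (map_poly g D) y ^ d = 0"
    by (simp add: g.mult sum_distrib_right mult.assoc)
  then have 0: "(\<Sum>i\<le>d. g (c i * a i) * t ^ i) = 0"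
    using D by simp
  define C where "C = (\<Sum>i\<le>d. monom (c i * a i) i)"
  have "coeff C k = c k * a k"
    unfolding C_def using c(1) by (simp add: coeff_sum)
  then have "C \<noteq> 0" using c aq by auto
  moreover have "poly (map_poly g C) t = 0"
  proof -
    interpret et: ring_morphism "\<lambda>p. poly (map_poly g p) t" by (rule g.ring_morphism_poly)
    show ?thesis
      using 0 unfolding C_def by (simp add: et.sum map_poly_monom poly_monom)
  qed
  ultimately show ?thesis by blast
qed

text \<open>If \<open>u\<close> and \<open>v\<close> were dependent, \<open>v\<close> would be
  algebraic over the field generated by \<open>u\<close>, and so would \<open>t\<close>, a quotient
  of polynomials in \<open>u\<close> and \<open>v\<close>.\<close>

lemma indep_of_fraction:
  assumes "indep u t" "eval_poly2 D u v \<noteq> 0" "t * eval_poly2 D u v = eval_poly2 N u v"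
  shows "indep u v"
  unfolding indep_def
proof (intro allI impI notI)
  fix P :: "rat poly poly" assume P: "P \<noteq> 0" "eval_poly2 P u v = 0"
  \<comment> \<open>Independence of \<open>u\<close> and \<open>t\<close> makes \<open>u\<close>
    transcendental; this is the injectivity that \<open>algebraic_fraction\<close> asks for.\<close>
  have "p = 0" if "poly (map_poly of_rat p) u = 0" for p
    using indepD[OF assms(1), of "[:p:]"] that by (simp add: eval_poly2_const)
  from algebraic_fraction[OF ring_morphism_eval_poly1[of u] this P(1), of v D t N] P(2) assms(2,3)
  obtain c where "c \<noteq> 0" "eval_poly2 c u t = 0"
    unfolding eval_poly2_def by auto
  with assms(1) show False by (simp add: indepD)
qed

section \<open>Finite dihedral groups\<close>

text \<open>The model has \<open>a\<close> for \<Phi> and \<open>b\<close> for \<Psi>, so that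
  \<open>rot\<close> is \<Theta>.\<close>

locale dihedral = group G for G (structure) +
  fixes a b
  assumes a_in [simp]: "a \<in> carrier G" and b_in [simp]: "b \<in> carrier G"
    and aa: "a \<otimes> a = \<one>" and bb: "b \<otimes> b = \<one>"
    and a_neq: "a \<noteq> \<one>" and b_neq: "b \<noteq> \<one>"
    and generated: "carrier G = generate G {a, b}"
begin

abbreviation (input) rot where "rot \<equiv> b \<otimes> a"

lemma inv_rot: "inv rot = a \<otimes> b"
  by (rule inv_equality) (simp_all add: m_assoc, metis aa bb a_in b_in m_assoc r_one)

lemma rot_a: "rot \<otimes> a = b"
  by (simp add: m_assoc aa)

lemma pow_rot_b: "rot [^] (k::int) \<otimes> b = rot [^] (k + 1) \<otimes> a"
  by (simp add: int_pow_mult m_assoc rot_a)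

lemma a_pow_rot: "a \<otimes> rot [^] (k::int) = rot [^] (- k) \<otimes> a"
proof (induction k rule: int_induct[of _ 0])
  case base
  show ?case by simp
next
  case (step1 i)
  have "a \<otimes> rot [^] (i + 1) = (a \<otimes> rot [^] i) \<otimes> rot"
    by (simp add: int_pow_mult m_assoc)
  also have "\<dots> = rot [^] (- i) \<otimes> (a \<otimes> b \<otimes> a)"
    by (simp add: step1 m_assoc)
  also have "\<dots> = rot [^] (- i) \<otimes> inv rot \<otimes> a"
    by (simp add: inv_rot m_assoc)
  also have "\<dots> = rot [^] (- i + - 1) \<otimes> a"
    by (simp only: int_pow_mult[of rot "- i" "- 1"] a_in b_in m_closed int_pow_neg int_pow_1)
  finally show ?case by simp
next
  case (step2 i)
  have "a \<otimes> rot [^] (i + - 1) = (a \<otimes> rot [^] i) \<otimes> inv rot"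
    by (simp only: int_pow_mult[of rot i "- 1"] a_in b_in m_closed int_pow_neg int_pow_1)
       (simp add: m_assoc int_pow_closed)
  also have "\<dots> = rot [^] (- i) \<otimes> (a \<otimes> inv rot)"
    by (simp add: step2 m_assoc)
  also have "a \<otimes> inv rot = rot \<otimes> a"
    by (simp add: inv_rot rot_a aa flip: m_assoc)
  also have "rot [^] (- i) \<otimes> (rot \<otimes> a) = rot [^] (- i + 1) \<otimes> a"
    using int_pow_mult[of rot "- i" 1] by (simp add: m_assoc)
  finally show ?case by simp
qed

text \<open>By \<open>a_pow_rot\<close> every \<open>a\<close> can be moved to the right past a
  power of \<open>rot\<close>, so these normal forms are closed under products.\<close>

lemma carrier_cases:
  assumes "x \<in> carrier G"
  obtains (rotation) k :: int where "x = rot [^] k" | (reflection) k :: int where "x = rot [^] k \<otimes> a"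
proof -
  have "x \<in> generate G {a, b}" using assms generated by simp
  then have "\<exists>k::int. x = rot [^] k \<or> x = rot [^] k \<otimes> a"
  proof induction
    case one
    show ?case by (rule exI[of _ 0]) simp
  next
    case (incl h)
    have "a = rot [^] (0::int) \<otimes> a" "b = rot [^] (1::int) \<otimes> a"
      by (simp_all add: rot_a)
    with incl show ?case by blast
  next
    case (inv h)
    have "inv a = a" "inv b = b" by (simp_all add: aa bb inv_equality)
    then have "inv a = rot [^] (0::int) \<otimes> a" "inv b = rot [^] (1::int) \<otimes> a"
      by (simp_all add: rot_a)
    with inv show ?case by blast
  next
    case (eng x y)
    then obtain k l :: int where
      x: "x = rot [^] k \<or> x = rot [^] k \<otimes> a" and y: "y = rot [^] l \<or> y = rot [^] l \<otimes> a"
      by blast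
    have rotrot: "rot [^] k \<otimes> rot [^] l = rot [^] (k + l)"
      "rot [^] k \<otimes> (rot [^] l \<otimes> a) = rot [^] (k + l) \<otimes> a"
      by (simp_all add: int_pow_mult m_assoc)
    have refrot: "(rot [^] k \<otimes> a) \<otimes> rot [^] l = rot [^] (k + - l) \<otimes> a"
      using a_pow_rot[of l] int_pow_mult[of rot k "- l"] by (simp add: m_assoc)
    have "(rot [^] k \<otimes> a) \<otimes> (rot [^] l \<otimes> a) = ((rot [^] k \<otimes> a) \<otimes> rot [^] l) \<otimes> a"
      by (simp add: m_assoc)
    also have "\<dots> = rot [^] (k + - l)"
      unfolding refrot by (simp add: m_assoc aa)
    finally show ?case using x y rotrot refrot by metis
  qed
  with that show thesis by blast
qed

text \<open>This makes the sign well defined. A power of \<open>rot\<close> commutes with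
  \<open>rot\<close>, while \<open>a\<close> inverts it, so equality would force \<open>rot\<close>
  to square to the identity. Then \<open>a\<close> is the identity or \<open>rot\<close>, whence
  \<open>a\<close> or \<open>b\<close> is trivial.\<close>

lemma a_neq_pow_rot: "a \<noteq> rot [^] (k::int)"
proof
  assume a: "a = rot [^] k"
  have "rot [^] k \<otimes> rot = rot \<otimes> rot [^] k"
    using int_pow_mult[of rot k 1] int_pow_mult[of rot 1 k] by (simp add: add.commute)
  then have "a \<otimes> rot = rot \<otimes> a"
    by (simp only: a[symmetric])
  then have comm: "a \<otimes> (b \<otimes> a) = b" by (simp add: rot_a)
  have "rot \<otimes> rot = b \<otimes> (a \<otimes> (b \<otimes> a))" by (simp add: m_assoc)
  then have "rot \<otimes> rot = \<one>" by (simp add: comm bb)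
  then have sq: "rot [^] (2::int) = \<one>"
    using int_pow_mult[of rot 1 1] by simp
  show False
  proof (cases "even k")
    case True
    then obtain m where "k = 2 * m" by auto
    then have "a = (rot [^] (2::int)) [^] m"
      using a by (simp add: int_pow_pow)
    with sq a_neq show False by simp
  next
    case False
    then obtain m where "k = 2 * m + 1" by (auto elim: oddE)
    then have "a = (rot [^] (2::int)) [^] m \<otimes> rot"
      using a by (simp add: int_pow_pow int_pow_mult)
    then have "a = rot" using sq by simp
    then have "\<one> \<otimes> a = b \<otimes> a" by simp
    with b_neq show False by (metis a_in b_in one_closed r_cancel)
  qed
qed

lemma pow_rot_a_neq: "rot [^] (k::int) \<otimes> a \<noteq> rot [^] (l::int)"
proof
  assume "rot [^] k \<otimes> a = rot [^] l"
  then have "rot [^] (- k) \<otimes> rot [^] k \<otimes> a = rot [^] (- k) \<otimes> rot [^] l"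
    by (simp add: m_assoc)
  then have "a = rot [^] (- k + l)"
    by (metis a_in b_in int_pow_closed int_pow_mult int_pow_0 m_closed l_one add.left_inverse)
  with a_neq_pow_rot show False by blast
qed

section \<open>Finite order: list of the elements and the identity in the group algebra\<close>

context
  fixes n :: nat
  assumes fin: "finite (carrier G)" and order: "Coset.order G = 2 * n"
begin

lemma rotations_inj: "inj_on (\<lambda>i. rot [^] i) {..<ord rot}"
proof -
  have "{..<ord rot} = {0..ord rot - 1}"
    using ord_ge_1[OF fin, of rot] by auto
  then show ?thesis using ord_inj[of rot] by simp
qed

lemma pow_rot_mod: "rot [^] (k::int) = rot [^] nat (k mod int (ord rot))"
proof -
  have "rot [^] k = rot [^] (k mod int (ord rot))"
    by (metis a_in b_in m_closed int_pow_eq mod_mod_trivial mod_eq_dvd_iff)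
  moreover have "k mod int (ord rot) = int (nat (k mod int (ord rot)))"
    using ord_ge_1[OF fin, of rot] by simp
  ultimately show ?thesis by (metis int_pow_int)
qed

lemma carrier_eq:
  "carrier G = (\<lambda>i. rot [^] i) ` {..<ord rot} \<union> (\<lambda>i. rot [^] i \<otimes> a) ` {..<ord rot}"
proof (intro equalityI subsetI)
  fix x assume "x \<in> carrier G"
  moreover have lt: "nat (k mod int (ord rot)) \<in> {..<ord rot}" for k
    using ord_ge_1[OF fin, of rot] by (simp add: nat_less_iff)
  ultimately show "x \<in> (\<lambda>i. rot [^] i) ` {..<ord rot} \<union> (\<lambda>i. rot [^] i \<otimes> a) ` {..<ord rot}"
  proof (cases x rule: carrier_cases)
    case (rotation k)
    then show ?thesis
      by (intro UnI1 rev_image_eqI[OF lt[of k]]) (simp only: pow_rot_mod[symmetric])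
  next
    case (reflection k)
    then show ?thesis
      by (intro UnI2 rev_image_eqI[OF lt[of k]]) (simp only: pow_rot_mod[symmetric])
  qed
qed auto

lemma disjoint_reflections:
  "(\<lambda>i::nat. rot [^] i) ` I \<inter> (\<lambda>i::nat. rot [^] i \<otimes> a) ` J = {}"
proof -
  have "rot [^] i \<otimes> a \<noteq> rot [^] j" for i j :: nat
    using pow_rot_a_neq[of "int i" "int j"] by (simp add: int_pow_int)
  note this[THEN not_sym]
  then show ?thesis by auto
qed

lemma reflections_inj: "inj_on (\<lambda>i. rot [^] i \<otimes> a) {..<ord rot}"
  using rotations_inj by (auto simp: inj_on_def)

text \<open>Rotations and reflections are disjoint families of \<open>ord rot\<close> elements each,
  and together they exhaust the group.\<close>

lemma ord_rot: "ord rot = n"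
proof -
  have "card (carrier G) = ord rot + ord rot"
    unfolding carrier_eq
    by (subst card_Un_disjoint)
       (simp_all add: disjoint_reflections card_image rotations_inj reflections_inj)
  with order show ?thesis by (simp add: Coset.order_def)
qed

lemma n_pos: "n > 0"
  using ord_ge_1[OF fin, of rot] ord_rot by simp

lemma sum_carrier:
  fixes f :: "_ \<Rightarrow> 'c::comm_monoid_add"
  shows "(\<Sum>x\<in>carrier G. f x) = (\<Sum>i<n. f (rot [^] int i)) + (\<Sum>i<n. f (rot [^] int i \<otimes> a))"
proof -
  have "(\<Sum>x\<in>carrier G. f x)
      = (\<Sum>x\<in>(\<lambda>i. rot [^] i) ` {..<n}. f x) + (\<Sum>x\<in>(\<lambda>i. rot [^] i \<otimes> a) ` {..<n}. f x)"
    unfolding carrier_eq ord_rot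
    by (rule sum.union_disjoint) (simp_all add: disjoint_reflections)
  also have "\<dots> = (\<Sum>i<n. f (rot [^] i)) + (\<Sum>i<n. f (rot [^] i \<otimes> a))"
    using rotations_inj reflections_inj unfolding ord_rot
    by (simp add: sum.reindex comp_def)
  finally show ?thesis by (simp add: int_pow_int)
qed

text \<open>Coefficients are compared. A rotation \<open>rot^j\<close> with \<open>0 < j < n\<close>
  receives \<open>-j/n\<close> and \<open>-(n-j)/n\<close> from the first two sums, a total of
  \<open>-1\<close>; the identity receives nothing. A reflection \<open>rot^j a\<close> with
  \<open>1 \<le> j \<le> n\<close> receives \<open>-(j-1)/n\<close> and \<open>-(n-j)/n\<close>, a
  total of \<open>-(1 - 1/n)\<close>. The last two sums add \<open>1\<close> to each rotation and
  \<open>1 - 1/n\<close> to each reflection, so only the identity survives.\<close>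

lemma decoupling_identity:
  fixes h :: "_ \<Rightarrow> 'c::field_char_0"
  shows "(\<Sum>i\<in>{1..<n}. - (of_nat i / of_nat n) * (h (rot [^] int i) + h (rot [^] int i \<otimes> b)))
    + (\<Sum>i\<in>{1..<n}. - (of_nat i / of_nat n) * (h (rot [^] (- int i)) + h (rot [^] (- int i) \<otimes> a)))
    + (1 - 1 / (2 * of_nat n)) * (\<Sum>x\<in>carrier G. h x)
    + 1 / (2 * of_nat n) * (\<Sum>x\<in>carrier G. (if \<exists>k::int. x = rot [^] k then 1 else - 1) * h x)
    = h \<one>"
proof -
  define R where "R = (\<lambda>i. h (rot [^] int i))"
  define T where "T = (\<lambda>i. h (rot [^] int i \<otimes> a))"
  define N where "N = (of_nat n :: 'c)"
  have N: "N \<noteq> 0" using n_pos by (simp add: N_def)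
  have one: "rot [^] int n = \<one>"
    using pow_ord_eq_1[of rot] ord_rot by (simp add: int_pow_int)
  have neg: "rot [^] (- int i) = rot [^] int (n - i)" if "i < n" for i
  proof -
    have "rot [^] int (n - i) = rot [^] int n \<otimes> rot [^] (- int i)"
      using that by (simp flip: int_pow_mult add: of_nat_diff)
    then show ?thesis by (simp add: one)
  qed
  have Tn: "T n = T 0" by (simp add: T_def one)
  have rev: "(\<Sum>i\<in>{1..<n}. of_nat i * f (n - i)) = (\<Sum>i\<in>{1..<n}. (N - of_nat i) * f i)"
    for f :: "nat \<Rightarrow> 'c"
    by (rule sum.reindex_bij_witness[of _ "\<lambda>i. n - i" "\<lambda>i. n - i"])
       (auto simp: N_def of_nat_diff)
  have split: "(\<Sum>i\<in>{1..<n}. f i) = (\<Sum>i<n. f i) - f 0" for f :: "nat \<Rightarrow> 'c"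
    using n_pos by (simp add: lessThan_atLeast0 sum.atLeast_Suc_lessThan)
  have sumR: "(\<Sum>i\<in>{1..<n}. of_nat i * R i) + (\<Sum>i\<in>{1..<n}. of_nat i * R (n - i))
      = N * ((\<Sum>i<n. R i) - R 0)"
    unfolding rev split[symmetric] sum.distrib[symmetric] sum_distrib_left
    by (rule sum.cong) (simp_all add: algebra_simps)
  \<comment> \<open>The shift by one comes from \<open>pow_rot_b\<close>; the index 0 may be added
    because its weight is 0.\<close>
  have "(\<Sum>i\<in>{1..<n}. of_nat i * T (i + 1)) = (\<Sum>i<n. of_nat i * T (Suc i))"
    using split[of "\<lambda>i. of_nat i * T (Suc i)"] by simp
  moreover have "(\<Sum>i\<in>{1..<n}. of_nat i * T (n - i)) = (\<Sum>i<n. (N - of_nat i - 1) * T (Suc i))"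
  proof -
    \<comment> \<open>The added index \<open>n\<close> has weight \<open>N - n = 0\<close>; it is
      included so that a shift by one aligns this sum with the previous one.\<close>
    have "(\<Sum>i\<in>{1..<n}. of_nat i * T (n - i)) = (\<Sum>i\<in>{1..<Suc n}. (N - of_nat i) * T i)"
      using n_pos rev[of T] by (simp add: N_def)
    also have "\<dots> = (\<Sum>i<n. (N - of_nat (Suc i)) * T (Suc i))"
      by (simp only: One_nat_def sum.shift_bounds_Suc_ivl lessThan_atLeast0)
    finally show ?thesis by (simp add: algebra_simps)
  qed
  ultimately have "(\<Sum>i\<in>{1..<n}. of_nat i * T (i + 1)) + (\<Sum>i\<in>{1..<n}. of_nat i * T (n - i))
      = (N - 1) * (\<Sum>i<n. T (Suc i))"
    by (simp only: sum_distrib_left sum.distrib[symmetric])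
       (rule sum.cong, simp_all add: algebra_simps)
  \<comment> \<open>Indices run cyclically: \<open>T n = T 0\<close> closes the shift.\<close>
  also have "(\<Sum>i<n. T (Suc i)) = (\<Sum>i<n. T i)"
    using Tn sum.lessThan_Suc_shift[of T n] sum.lessThan_Suc[of T n] by simp
  finally have sumT: "(\<Sum>i\<in>{1..<n}. of_nat i * T (i + 1)) + (\<Sum>i\<in>{1..<n}. of_nat i * T (n - i))
      = (N - 1) * (\<Sum>i<n. T i)" .
  have "(\<Sum>i\<in>{1..<n}. - (of_nat i / of_nat n) * (h (rot [^] int i) + h (rot [^] int i \<otimes> b)))
      = - ((\<Sum>i\<in>{1..<n}. of_nat i * R i) + (\<Sum>i\<in>{1..<n}. of_nat i * T (i + 1))) / N"
    unfolding sum.distrib[symmetric] sum_negf[symmetric] sum_divide_distrib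
    by (rule sum.cong) (simp_all add: R_def T_def N_def pow_rot_b algebra_simps add_divide_distrib diff_divide_distrib)
  moreover have "(\<Sum>i\<in>{1..<n}. - (of_nat i / of_nat n) * (h (rot [^] (- int i)) + h (rot [^] (- int i) \<otimes> a)))
      = (\<Sum>i\<in>{1..<n}. - (of_nat i / N) * (R (n - i) + T (n - i)))"
    by (rule sum.cong) (auto simp: R_def T_def N_def neg simp del: int_pow_neg)
  moreover have "\<dots> = - ((\<Sum>i\<in>{1..<n}. of_nat i * R (n - i)) + (\<Sum>i\<in>{1..<n}. of_nat i * T (n - i))) / N"
    unfolding sum.distrib[symmetric] sum_negf[symmetric] sum_divide_distrib
    by (rule sum.cong) (simp_all add: algebra_simps add_divide_distrib diff_divide_distrib)
  moreover have "(\<Sum>x\<in>carrier G. h x) = (\<Sum>i<n. R i) + (\<Sum>i<n. T i)"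
    by (simp add: sum_carrier R_def T_def)
  moreover have "(\<Sum>x\<in>carrier G. (if \<exists>k::int. x = rot [^] k then 1 else - 1) * h x)
      = (\<Sum>i<n. R i) - (\<Sum>i<n. T i)"
  proof -
    have "\<exists>k::int. rot [^] int i = rot [^] k" for i by blast
    then show ?thesis
      by (simp add: sum_carrier R_def T_def pow_rot_a_neq sum_negf)
  qed
  moreover have "h \<one> = R 0" by (simp add: R_def)
  moreover
  have comb: "- (sR1 + sT1) / N + - (sR2 + sT2) / N + (1 - 1 / (2 * N)) * (sR + sT)
      + 1 / (2 * N) * (sR - sT) = r0"
    if "sR1 + sR2 = N * (sR - r0)" "sT1 + sT2 = (N - 1) * sT" for sR1 sR2 sT1 sT2 sR sT r0
  proof -
    have "- (sR1 + sT1) / N + - (sR2 + sT2) / N = - ((sR1 + sR2) + (sT1 + sT2)) / N"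
      by (simp add: add_divide_distrib diff_divide_distrib)
    also have "\<dots> = - (sR - r0) - (1 - 1 / N) * sT"
      using N by (simp add: that field_simps)
    finally have "- (sR1 + sT1) / N + - (sR2 + sT2) / N = - (sR - r0) - (1 - 1 / N) * sT" .
    moreover have "(1 - 1 / (2 * N)) * (sR + sT) + 1 / (2 * N) * (sR - sT) = sR + (1 - 1 / N) * sT"
      using N by (simp add: field_simps)
    ultimately show ?thesis by (simp add: algebra_simps)
  qed
  note comb[OF sumR sumT]
  ultimately show ?thesis
    by (simp only: N_def)
qed

end

section \<open>Sign changes and alternating sums\<close>

text \<open>Multiplication by \<open>a\<close> exchanges rotations and reflections; for
  \<open>b\<close> this follows because \<open>b\<close> is \<open>rot\<close> times
  \<open>a\<close>, and \<open>rot\<close> preserves both kinds.\<close>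

lemma sign_mult_generator:
  assumes "c = a \<or> c = b" "x \<in> carrier G"
  shows "(\<exists>k::int. c \<otimes> x = rot [^] k) \<longleftrightarrow> \<not> (\<exists>k::int. x = rot [^] k)"
proof -
  have "b \<otimes> x = b \<otimes> (a \<otimes> a) \<otimes> x"
    by (simp add: aa)
  then have b: "b \<otimes> x = rot \<otimes> (a \<otimes> x)"
    using assms(2) by (simp add: m_assoc)
  have rot: "rot \<otimes> rot [^] l = rot [^] (1 + l)" for l :: int
    by (simp add: int_pow_mult)
  from assms(2) show ?thesis
  proof (cases x rule: carrier_cases)
    case (rotation k)
    have ax: "a \<otimes> x = rot [^] (- k) \<otimes> a" by (simp only: rotation a_pow_rot)
    have "b \<otimes> x = (rot \<otimes> rot [^] (- k)) \<otimes> a"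
      unfolding b ax by (rule m_assoc[symmetric]) simp_all
    then show ?thesis
      unfolding rot using assms(1) ax rotation pow_rot_a_neq by metis
  next
    case (reflection k)
    have "a \<otimes> x = (a \<otimes> rot [^] k) \<otimes> a"
      unfolding reflection by (rule m_assoc[symmetric]) simp_all
    also have "\<dots> = rot [^] (- k) \<otimes> (a \<otimes> a)"
      unfolding a_pow_rot by (rule m_assoc) simp_all
    also have "\<dots> = rot [^] (- k)" by (simp add: aa)
    finally have ax: "a \<otimes> x = rot [^] (- k)" .
    then show ?thesis
      using assms(1) reflection pow_rot_a_neq b rot by metis
  qed
qed

text \<open>Reindexing by left multiplication with the involution \<open>c\<close> flips every sign,
  so the sum equals its own negative.\<close>

lemma alternating_sum_zero:
  fixes f :: "_ \<Rightarrow> 'c::field_char_0"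
  assumes c: "c = a \<or> c = b" and f: "\<And>x. x \<in> carrier G \<Longrightarrow> f (c \<otimes> x) = f x"
  shows "(\<Sum>x\<in>carrier G. (if \<exists>k::int. x = rot [^] k then 1 else - 1) * f x) = 0"
proof -
  let ?s = "\<lambda>x. if \<exists>k::int. x = rot [^] k then 1 else (- 1 :: 'c)"
  have cc: "c \<in> carrier G" "c \<otimes> c = \<one>" using c aa bb by auto
  have "(\<Sum>x\<in>carrier G. ?s x * f x) = (\<Sum>x\<in>carrier G. ?s (c \<otimes> x) * f (c \<otimes> x))"
    by (rule sum.reindex_bij_witness[of _ "\<lambda>x. c \<otimes> x" "\<lambda>x. c \<otimes> x"])
       (use cc in \<open>simp_all flip: m_assoc\<close>)
  also have "\<dots> = (\<Sum>x\<in>carrier G. - (?s x * f x))"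
    by (rule sum.cong) (simp_all add: f sign_mult_generator[OF c])
  finally show ?thesis
    by (simp add: sum_negf)
qed

end

section \<open>The monoid of dominant maps\<close>

lemma mult_ratmap [simp]:
  "\<gamma> \<otimes>\<^bsub>ratmap_monoid\<^esub> \<delta> = (subst_ratfun2 (fst \<gamma>) \<delta>, subst_ratfun2 (snd \<gamma>) \<delta>)"
  by (simp add: ratmap_monoid_def)

lemma one_ratmap [simp]: "\<one>\<^bsub>ratmap_monoid\<^esub> = (var1, var2)"
  by (simp add: ratmap_monoid_def)

lemma carrier_ratmap [simp]: "\<gamma> \<in> carrier ratmap_monoid \<longleftrightarrow> indep (fst \<gamma>) (snd \<gamma>)"
  by (simp add: ratmap_monoid_def dominant_iff)

lemma field_morphism_subst:
  "indep (fst \<delta>) (snd \<delta>) \<Longrightarrow> field_morphism (\<lambda>A. subst_ratfun2 A \<delta>)"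
  unfolding subst_ratfun2_def by (rule field_morphism_eval_ratfun2)

text \<open>Substitution is a right action: multiplying by \<delta> on the right means pulling back
  along \<delta> afterwards. This turns products in the group algebra into successive
  substitutions.\<close>

lemma subst_mult:
  assumes "indep (fst \<delta>) (snd \<delta>)"
  shows "subst_ratfun2 A (\<gamma> \<otimes>\<^bsub>ratmap_monoid\<^esub> \<delta>) = subst_ratfun2 (subst_ratfun2 A \<gamma>) \<delta>"
  using field_morphism.eval_ratfun2[OF field_morphism_subst[OF assms], of A "fst \<gamma>" "snd \<gamma>"]
  by (simp add: subst_ratfun2_def)

lemma subst_one [simp]: "subst_ratfun2 A (var1, var2) = A"
  by (simp add: subst_ratfun2_def)

lemma eval_subst:
  assumes "indep u v"
  shows "eval_ratfun2 (subst_ratfun2 A \<gamma>) u v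
    = eval_ratfun2 A (eval_ratfun2 (fst \<gamma>) u v) (eval_ratfun2 (snd \<gamma>) u v)"
  using field_morphism.eval_ratfun2[OF field_morphism_eval_ratfun2[OF assms], of A "fst \<gamma>" "snd \<gamma>"]
  by (simp add: subst_ratfun2_def)

lemma monoid_ratmap: "Group.monoid ratmap_monoid"
proof
  fix \<gamma> \<delta> \<epsilon> :: ratmap
  assume \<gamma>: "\<gamma> \<in> carrier ratmap_monoid" and \<delta>: "\<delta> \<in> carrier ratmap_monoid"
  show "\<gamma> \<otimes>\<^bsub>ratmap_monoid\<^esub> \<delta> \<in> carrier ratmap_monoid"
    using \<gamma> \<delta> field_morphism_indep_iff[OF field_morphism_subst] by simp
  assume "\<epsilon> \<in> carrier ratmap_monoid"
  then show "\<gamma> \<otimes>\<^bsub>ratmap_monoid\<^esub> \<delta> \<otimes>\<^bsub>ratmap_monoid\<^esub> \<epsilon>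
      = \<gamma> \<otimes>\<^bsub>ratmap_monoid\<^esub> (\<delta> \<otimes>\<^bsub>ratmap_monoid\<^esub> \<epsilon>)"
    using subst_mult[of \<epsilon>] by simp
qed (auto simp: subst_ratfun2_def indep_var)

lemma group_birational: "group birational_group"
  unfolding birational_group_def by (rule monoid.units_group[OF monoid_ratmap])

lemma mult_birational [simp]: "monoid.mult birational_group = monoid.mult ratmap_monoid"
  and one_birational [simp]: "\<one>\<^bsub>birational_group\<^esub> = (var1, var2)"
  by (simp_all add: birational_group_def units_of_def)

lemma involution_birational:
  assumes "indep (fst \<gamma>) (snd \<gamma>)" "\<gamma> \<otimes>\<^bsub>ratmap_monoid\<^esub> \<gamma> = (var1, var2)"
  shows "\<gamma> \<in> carrier birational_group"
proof -
  have "\<gamma> \<in> carrier ratmap_monoid" using assms(1) by simp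
  with assms(2) have "\<gamma> \<in> Units ratmap_monoid"
    unfolding Units_def one_ratmap by blast
  then show ?thesis by (simp add: birational_group_def units_of_def)
qed

section \<open>The involutions of a small-step model\<close>

text \<open>Reflecting the model in the diagonal exchanges \<Phi> with \<Psi> and the roots in
  \<open>x\<close> with the roots in \<open>y\<close>, so most facts need a direct proof for one
  side only.\<close>

definition transpose_steps :: "(int \<times> int) set \<Rightarrow> (int \<times> int) set" where
  "transpose_steps S = prod.swap ` S"

definition transpose_weights :: "(int \<times> int \<Rightarrow> rat) \<Rightarrow> int \<times> int \<Rightarrow> rat" where
  "transpose_weights w = w \<circ> prod.swap"

lemma mem_transpose_steps [simp]: "(i, j) \<in> transpose_steps S \<longleftrightarrow> (j, i) \<in> S"
  by (force simp: transpose_steps_def)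

lemma transpose_weights_apply [simp]: "transpose_weights w (i, j) = w (j, i)"
  by (simp add: transpose_weights_def)

lemma small_step_model_transpose:
  assumes "small_step_model S w"
  shows "small_step_model (transpose_steps S) (transpose_weights w)"
proof -
  have "S \<subseteq> {-1, 0, 1} \<times> {-1, 0, 1}" "\<forall>s\<in>S. w s \<noteq> 0"
    using assms by (simp_all add: small_step_model_def)
  then have "transpose_steps S \<subseteq> {-1, 0, 1} \<times> {-1, 0, 1}"
    "\<forall>s\<in>transpose_steps S. transpose_weights w s \<noteq> 0"
    unfolding transpose_steps_def transpose_weights_def by fastforce+
  then show ?thesis
    using assms by (simp add: small_step_model_def)
qed

lemma coeff_transpose:
  "coeff_x (transpose_steps S) (transpose_weights w) = coeff_y S w"
  "coeff_y (transpose_steps S) (transpose_weights w) = coeff_x S w"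
  by (simp_all add: coeff_x_def coeff_y_def fun_eq_iff)

lemma walk_kernel_transpose:
  "walk_kernel (transpose_steps S) (transpose_weights w) t y x = walk_kernel S w t x y"
  by (simp add: walk_kernel_def transpose_steps_def transpose_weights_def sum.reindex
      case_prod_unfold mult_ac)

text \<open>\<open>coeff_y\<close> as a polynomial, so that independence can be used to show that
  its values do not vanish.\<close>

definition step_coeff :: "(int \<times> int) set \<Rightarrow> (int \<times> int \<Rightarrow> rat) \<Rightarrow> int \<Rightarrow> rat poly" where
  "step_coeff S w j = (\<Sum>i | (i, j) \<in> S. Polynomial.monom (w (i, j)) (nat (i + 1)))"

lemma poly_step_coeff: "poly (map_poly of_rat (step_coeff S w j)) u = coeff_y S w j u"
  unfolding step_coeff_def coeff_y_def
  by (simp add: ring_morphism.sum[OF ring_morphism_eval_poly1] map_poly_monom poly_monom)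

text \<open>The coefficient of \<open>t\<close> in the kernel, with the factor \<open>xy\<close>
  already multiplied in.\<close>

definition step_poly :: "(int \<times> int) set \<Rightarrow> (int \<times> int \<Rightarrow> rat) \<Rightarrow> rat poly poly" where
  "step_poly S w = (\<Sum>(i, j)\<in>S. [:[:w (i, j):]:] * [:[:0, 1:]:] ^ nat (i + 1) * [:0, 1:] ^ nat (j + 1))"

lemma walk_kernel_step_poly: "walk_kernel S w t x y = t * eval_poly2 (step_poly S w) x y - x * y"
  unfolding walk_kernel_def step_poly_def case_prod_unfold
    eval_poly2_simps eval_poly2_of_rat eval_poly2_X eval_poly2_Y by simp

text \<open>Vieta: the product of the roots is \<open>c / a\<close>, so one nonzero root determines
  the other, also when they coincide.\<close>

lemma quadratic_roots:
  fixes a b c y :: "'a::field"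
  assumes "a \<noteq> 0" "y \<noteq> 0" "a * y\<^sup>2 + b * y + c = 0"
  shows "{z. a * z\<^sup>2 + b * z + c = 0} = {y, c / a * (1 / y)}"
proof -
  have b: "b = - a * y - c / y"
    using assms by (simp add: field_simps power2_eq_square eq_neg_iff_add_eq_0)
  have "a * z\<^sup>2 + b * z + c = a * ((z - y) * (z - c / a * (1 / y)))" for z
    using assms(1,2) unfolding b by (simp add: field_simps power2_eq_square)
  then show ?thesis using assms(1) by auto
qed

locale small_step =
  fixes S w
  assumes model: "small_step_model S w"
begin

lemma S_sub: "S \<subseteq> {-1, 0, 1} \<times> {-1, 0, 1}"
  and w_nonzero: "s \<in> S \<Longrightarrow> w s \<noteq> 0"
  and steps: "\<exists>j. (1, j) \<in> S" "\<exists>j. (-1, j) \<in> S" "\<exists>i. (i, 1) \<in> S" "\<exists>i. (i, -1) \<in> S"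
  using model by (auto simp: small_step_model_def)

lemma coeff_step_coeff:
  assumes i: "(i, j) \<in> S"
  shows "coeff (step_coeff S w j) (nat (i + 1)) = w (i, j)"
proof -
  have fin: "finite {i. (i, j) \<in> S}"
    by (rule finite_subset[of _ "{-1, 0, 1}"]) (use S_sub in auto)
  have "coeff (step_coeff S w j) (nat (i + 1))
      = (\<Sum>k | (k, j) \<in> S. if k = i then w (i, j) else 0)"
    unfolding step_coeff_def coeff_sum
  proof (rule sum.cong)
    fix k assume "k \<in> {k. (k, j) \<in> S}"
    \<comment> \<open>From -1 upwards \<open>nat (i + 1)\<close> is injective, so distinct steps
      give distinct monomials and no weights cancel.\<close>
    then have "k \<ge> -1" "i \<ge> -1" using i S_sub by auto
    then show "coeff (Polynomial.monom (w (k, j)) (nat (k + 1))) (nat (i + 1))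
        = (if k = i then w (i, j) else 0)"
      by auto
  qed simp
  also have "\<dots> = w (i, j)"
    using i fin by (subst sum.delta) auto
  finally show ?thesis .
qed

lemma step_coeff_nonzero:
  assumes "j = 1 \<or> j = -1"
  shows "step_coeff S w j \<noteq> 0"
proof -
  obtain i where "(i, j) \<in> S" using assms steps(3,4) by auto
  with coeff_step_coeff[OF this] w_nonzero[OF this] show ?thesis by auto
qed

lemma coeff_y_nonzero:
  assumes "indep u v" "j = 1 \<or> j = -1"
  shows "coeff_y S w j u \<noteq> 0"
  using indepD[OF assms(1), of "[:step_coeff S w j:]"] step_coeff_nonzero[OF assms(2)]
  by (simp add: eval_poly2_const poly_step_coeff)

text \<open>The map is an involution: \<open>v\<close> is recovered as the fraction
  \<open>c(u) / (a(u) v')\<close> of \<open>u\<close> and the new coordinate \<open>v'\<close>, so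
  \<open>indep_of_fraction\<close> applies.\<close>

lemma indep_involution:
  assumes "indep u v"
  shows "indep u (coeff_y S w (-1) u / coeff_y S w 1 u * (1 / v))"
proof (rule indep_of_fraction[OF assms, of "[:0, step_coeff S w 1:]" _ "[:step_coeff S w (-1):]"])
  let ?v = "coeff_y S w (-1) u / coeff_y S w 1 u * (1 / v)"
  have "[:0, step_coeff S w 1:] = [:step_coeff S w 1:] * [:0, 1:]" by simp
  then have D: "eval_poly2 [:0, step_coeff S w 1:] u ?v = coeff_y S w 1 u * ?v"
    by (simp only: eval_poly2_simps eval_poly2_const poly_step_coeff eval_poly2_Y)
  note nz = coeff_y_nonzero[OF assms, of 1] coeff_y_nonzero[OF assms, of "-1"] indep_nonzero[OF assms]
  show "eval_poly2 [:0, step_coeff S w 1:] u ?v \<noteq> 0"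
    unfolding D using nz by simp
  show "v * eval_poly2 [:0, step_coeff S w 1:] u ?v = eval_poly2 [:step_coeff S w (-1):] u ?v"
    unfolding D using nz by (simp add: eval_poly2_const poly_step_coeff)
qed

lemma eval_step_Psi:
  assumes "indep u v"
  shows "eval_ratfun2 (fst (step_Psi S w)) u v = u"
    and "eval_ratfun2 (snd (step_Psi S w)) u v = coeff_y S w (-1) u / coeff_y S w 1 u * (1 / v)"
proof -
  interpret field_morphism "\<lambda>A. eval_ratfun2 A u v"
    by (rule field_morphism_eval_ratfun2[OF assms])
  show "eval_ratfun2 (fst (step_Psi S w)) u v = u"
    by (simp add: step_Psi_def)
  show "eval_ratfun2 (snd (step_Psi S w)) u v = coeff_y S w (-1) u / coeff_y S w 1 u * (1 / v)"
    by (simp add: step_Psi_def divide mult coeff_y)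
qed

text \<open>The constant coefficient in \<open>y\<close> is nonzero at a transcendental
  \<open>u\<close>, so 0 is not a root, and the second root is the one that \<Psi> produces.\<close>

lemma y_root_set:
  fixes t :: "'a::field_char_0"
  assumes "indep u v" "t \<noteq> 0" "walk_kernel S w t u y = 0"
  shows "y \<noteq> 0" "{y. walk_kernel S w t u y = 0} = {y, coeff_y S w (-1) u / coeff_y S w 1 u * (1 / y)}"
proof -
  note nz = coeff_y_nonzero[OF assms(1), of 1] coeff_y_nonzero[OF assms(1), of "-1"]
  show y: "y \<noteq> 0"
    using assms nz by (auto simp: walk_kernel_eq_quadratic(2)[OF model])
  have "t * coeff_y S w (-1) u / (t * coeff_y S w 1 u) = coeff_y S w (-1) u / coeff_y S w 1 u"
    using assms(2) by simp
  then show "{y. walk_kernel S w t u y = 0} = {y, coeff_y S w (-1) u / coeff_y S w 1 u * (1 / y)}"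
    using quadratic_roots[of "t * coeff_y S w 1 u" y "t * coeff_y S w 0 u - u" "t * coeff_y S w (-1) u"]
      assms nz y unfolding walk_kernel_eq_quadratic(2)[OF model] by simp
qed

lemma indep_step_Psi: "indep (fst (step_Psi S w)) (snd (step_Psi S w))"
  using indep_involution[OF indep_var] by (simp add: step_Psi_def)

lemma step_Psi_square: "step_Psi S w \<otimes>\<^bsub>ratmap_monoid\<^esub> step_Psi S w = (var1, var2)"
proof -
  note nz = coeff_y_nonzero[OF indep_var, of 1] coeff_y_nonzero[OF indep_var, of "-1"]
    indep_nonzero[OF indep_var]
  have "eval_ratfun2 (snd (step_Psi S w)) (fst (step_Psi S w)) (snd (step_Psi S w)) = var2"
    unfolding eval_step_Psi(2)[OF indep_step_Psi] using nz by (simp add: step_Psi_def)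
  then show ?thesis
    using eval_step_Psi(1)[OF indep_step_Psi] by (simp add: subst_ratfun2_def) (simp add: step_Psi_def)
qed

lemma step_Psi_neq: "step_Psi S w \<noteq> (var1, var2)"
proof
  assume "step_Psi S w = (var1, var2)"
  then have "coeff_y S w (-1) var1 = coeff_y S w 1 var1 * (var2 :: ratfun2)\<^sup>2"
    using indep_nonzero[OF indep_var] coeff_y_nonzero[OF indep_var, of 1]
    by (simp add: step_Psi_def field_simps power2_eq_square)
  then have "eval_poly2 ([:step_coeff S w (-1):] - [:step_coeff S w 1:] * [:0, 1:] ^ 2) var1 var2 = 0"
    by (simp only: eval_poly2_simps eval_poly2_const poly_step_coeff eval_poly2_Y)
  then have "[:step_coeff S w (-1):] - [:step_coeff S w 1:] * [:0, 1:] ^ 2 = 0"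
    using indepD[OF indep_var] by blast
  \<comment> \<open>The coefficient of the square of the outer variable is
    \<open>- step_coeff S w 1\<close>, which is nonzero.\<close>
  then have "coeff ([:step_coeff S w (-1):] - [:step_coeff S w 1:] * [:0, 1:] ^ 2) 2 = 0"
    by simp
  then show False
    using step_coeff_nonzero[of 1] by (simp add: power2_eq_square numeral_2_eq_2)
qed

lemma step_poly_eval_nonzero:
  fixes t :: "'a::field_char_0"
  assumes "u \<noteq> 0" "v \<noteq> 0" "walk_kernel S w t u v = 0"
  shows "eval_poly2 (step_poly S w) u v \<noteq> 0"
  using assms by (auto simp: walk_kernel_step_poly)

text \<open>On the curve \<open>t\<close> is the fraction \<open>xy / step_poly\<close> of the
  coordinates, so a dependence between \<open>u\<close> and \<open>y\<close> would pass to
  \<open>u\<close> and \<open>t\<close>.\<close>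

lemma indep_y_root:
  assumes "indep u t" "walk_kernel S w t u y = 0"
  shows "indep u y"
proof (rule indep_of_fraction[OF assms(1)])
  have "y \<noteq> 0"
    using y_root_set(1)[OF assms(1) _ assms(2)] indep_nonzero[OF assms(1)] by simp
  then show "eval_poly2 (step_poly S w) u y \<noteq> 0"
    using step_poly_eval_nonzero indep_nonzero[OF assms(1)] assms(2) by blast
  show "t * eval_poly2 (step_poly S w) u y = eval_poly2 ([:[:0, 1:]:] * [:0, 1:]) u y"
    using assms(2) by (simp only: walk_kernel_step_poly eval_poly2_simps eval_poly2_X eval_poly2_Y) simp
qed

end

definition swap_map :: ratmap where
  "swap_map = (var2, var1)"

lemma eval_swap_map: "indep u v \<Longrightarrow> eval_ratfun2 (subst_ratfun2 A swap_map) u v = eval_ratfun2 A v u"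
  by (simp add: eval_subst swap_map_def)

section \<open>The group of a small-step model\<close>

context small_step
begin

lemma transpose: "small_step (transpose_steps S) (transpose_weights w)"
  by unfold_locales (rule small_step_model_transpose[OF model])

lemma eval_step_Phi:
  assumes "indep u v"
  shows "eval_ratfun2 (fst (step_Phi S w)) u v = coeff_x S w (-1) v / coeff_x S w 1 v * (1 / u)"
    and "eval_ratfun2 (snd (step_Phi S w)) u v = v"
proof -
  interpret field_morphism "\<lambda>A. eval_ratfun2 A u v"
    by (rule field_morphism_eval_ratfun2[OF assms])
  show "eval_ratfun2 (fst (step_Phi S w)) u v = coeff_x S w (-1) v / coeff_x S w 1 v * (1 / u)"
    by (simp add: step_Phi_def divide mult coeff_x)
  show "eval_ratfun2 (snd (step_Phi S w)) u v = v"
    by (simp add: step_Phi_def)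
qed

lemma coeff_x_nonzero:
  assumes "indep u v" "j = 1 \<or> j = -1"
  shows "coeff_x S w j v \<noteq> 0"
  using small_step.coeff_y_nonzero[OF transpose indep_swap[OF assms(1)] assms(2)]
  by (simp add: coeff_transpose)

lemma indep_step_Phi: "indep (fst (step_Phi S w)) (snd (step_Phi S w))"
  using indep_swap[OF small_step.indep_involution[OF transpose indep_swap[OF indep_var]]]
  by (simp add: step_Phi_def coeff_transpose)

lemma x_root_set:
  fixes t :: "'a::field_char_0"
  assumes "indep u v" "t \<noteq> 0" "walk_kernel S w t x v = 0"
  shows "{x. walk_kernel S w t x v = 0} = {x, coeff_x S w (-1) v / coeff_x S w 1 v * (1 / x)}"
  using small_step.y_root_set(2)[OF transpose indep_swap[OF assms(1)] assms(2), of x] assms(3)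
  by (simp add: walk_kernel_transpose coeff_transpose)

lemma indep_x_root:
  assumes "indep v t" "walk_kernel S w t x v = 0"
  shows "indep x v"
  using indep_swap[OF small_step.indep_y_root[OF transpose assms(1), of x]] assms(2)
  by (simp add: walk_kernel_transpose)

lemma step_Phi_square: "step_Phi S w \<otimes>\<^bsub>ratmap_monoid\<^esub> step_Phi S w = (var1, var2)"
proof -
  note nz = coeff_x_nonzero[OF indep_var, of 1] coeff_x_nonzero[OF indep_var, of "-1"]
    indep_nonzero[OF indep_var]
  have "eval_ratfun2 (fst (step_Phi S w)) (fst (step_Phi S w)) (snd (step_Phi S w)) = var1"
    unfolding eval_step_Phi(1)[OF indep_step_Phi] using nz by (simp add: step_Phi_def)
  then show ?thesis
    using eval_step_Phi(2)[OF indep_step_Phi] by (simp add: subst_ratfun2_def) (simp add: step_Phi_def)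
qed

lemma step_Phi_neq: "step_Phi S w \<noteq> (var1, var2)"
proof
  assume eq: "step_Phi S w = (var1, var2)"
  \<comment> \<open>Evaluating with the variables exchanged turns \<Phi> into the \<Psi> of the
    transposed model.\<close>
  have "eval_ratfun2 (fst (step_Phi S w)) var2 var1 = var2"
    by (simp add: eq)
  then have "step_Psi (transpose_steps S) (transpose_weights w) = (var1, var2)"
    unfolding eval_step_Phi(1)[OF indep_swap[OF indep_var]]
    by (simp add: step_Psi_def coeff_transpose)
  with small_step.step_Psi_neq[OF transpose] show False by simp
qed

lemma step_group_mult [simp]: "monoid.mult (step_group S w) = monoid.mult ratmap_monoid"
  and step_group_one [simp]: "\<one>\<^bsub>step_group S w\<^esub> = (var1, var2)"
  by (simp_all add: step_group_def)

lemma carrier_step_group: "\<gamma> \<in> carrier (step_group S w) \<Longrightarrow> indep (fst \<gamma>) (snd \<gamma>)"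
  using group.carrier_subgroup_generated_subset[OF group_birational]
  by (fastforce simp: step_group_def birational_group_def units_of_def Units_def)

lemma dihedral_step_group: "dihedral (step_group S w) (step_Phi S w) (step_Psi S w)"
proof -
  interpret B: group birational_group by (rule group_birational)
  interpret G: group "step_group S w" by (simp add: step_group_def)
  have "step_Phi S w \<in> carrier birational_group" "step_Psi S w \<in> carrier birational_group"
    using involution_birational step_Phi_square step_Psi_square indep_step_Phi indep_step_Psi by auto
  then have mem: "step_Phi S w \<in> carrier (step_group S w)" "step_Psi S w \<in> carrier (step_group S w)"
    unfolding step_group_def carrier_subgroup_generated by (auto intro: generate.incl)
  have "carrier (step_group S w) = carrier (subgroup_generated (step_group S w) {step_Phi S w, step_Psi S w})"
    by (simp add: step_group_def)
  also have "\<dots> = generate (step_group S w) {step_Phi S w, step_Psi S w}"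
    using mem unfolding carrier_subgroup_generated by (simp add: Int_absorb1)
  finally have gen: "carrier (step_group S w) = generate (step_group S w) {step_Phi S w, step_Psi S w}" .
  show ?thesis
    by unfold_locales
       (use mem gen step_Phi_square step_Psi_square step_Phi_neq step_Psi_neq in \<open>simp_all del: mult_ratmap\<close>)
qed

end

section \<open>Action of the group algebra\<close>

text \<open>Keys may disappear by cancellation in a sum; a common larger index set makes additivity
  visible.\<close>

lemma group_act_superset:
  assumes "finite K" "Poly_Mapping.keys \<omega> \<subseteq> K"
  shows "group_act A \<omega> = (\<Sum>\<gamma>\<in>K. of_rat (Poly_Mapping.lookup \<omega> \<gamma>) * subst_ratfun2 A \<gamma>)"
  unfolding group_act_def
  by (rule sum.mono_neutral_left) (use assms in \<open>auto simp: in_keys_iff\<close>)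

lemma group_act_add: "group_act A (\<omega> + \<omega>') = group_act A \<omega> + group_act A \<omega>'"
proof -
  let ?K = "Poly_Mapping.keys \<omega> \<union> Poly_Mapping.keys \<omega>'"
  have "Poly_Mapping.keys (\<omega> + \<omega>') \<subseteq> ?K" by (rule Poly_Mapping.keys_add)
  then show ?thesis
    by (simp add: group_act_superset[of ?K] lookup_add of_rat_add distrib_right sum.distrib)
qed

lemma group_act_sum_single:
  assumes "finite I"
  shows "group_act A (\<Sum>i\<in>I. Poly_Mapping.single (\<gamma> i) (c i)) = (\<Sum>i\<in>I. of_rat (c i) * subst_ratfun2 A (\<gamma> i))"
  using assms
proof induction
  case empty
  show ?case by (simp add: group_act_def)
next
  case (insert i I)
  have "group_act A (Poly_Mapping.single (\<gamma> i) (c i)) = of_rat (c i) * subst_ratfun2 A (\<gamma> i)"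
    by (simp add: group_act_def)
  with insert show ?case by (simp add: group_act_add)
qed

section \<open>Field of functions on the kernel curve\<close>

text \<open>The value \<open>T\<close> of \<open>t\<close> for which the generic point \<open>(x, y)\<close> lies on the curve.\<close>

definition kernel_param :: "(int \<times> int) set \<Rightarrow> (int \<times> int \<Rightarrow> rat) \<Rightarrow> ratfun2" where
  "kernel_param S w = var1 * var2 / to_fract (step_poly S w)"

context small_step
begin

lemma step_poly_eq: "step_poly S w = [:step_coeff S w (-1), step_coeff S w 0, step_coeff S w 1:]"
proof -
  have "to_fract (step_poly S w) = eval_poly2 (step_poly S w) var1 var2" by simp
  \<comment> \<open>The kernel at \<open>t = 1\<close> is \<open>step_poly\<close> minus
    \<open>xy\<close>; the same \<open>xy\<close> sits in the middle coefficient of the quadratic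
    and cancels.\<close>
  also have "\<dots> = coeff_y S w 1 var1 * var2\<^sup>2 + coeff_y S w 0 var1 * var2 + coeff_y S w (-1) var1"
    using walk_kernel_step_poly[of S w 1 var1 var2] walk_kernel_eq_quadratic(2)[OF model, of 1 var1 var2]
    by (simp add: algebra_simps)
  also have "\<dots> = eval_poly2 ([:step_coeff S w 1:] * [:0, 1:] ^ 2 + [:step_coeff S w 0:] * [:0, 1:]
      + [:step_coeff S w (-1):]) var1 var2"
    by (simp only: eval_poly2_simps eval_poly2_const poly_step_coeff eval_poly2_Y)
  also have "[:step_coeff S w 1:] * [:0, 1:] ^ 2 + [:step_coeff S w 0:] * [:0, 1:] + [:step_coeff S w (-1):]
      = [:step_coeff S w (-1), step_coeff S w 0, step_coeff S w 1:]"
    by (simp add: power2_eq_square)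
  finally show ?thesis by simp
qed

lemma step_poly_nonzero: "step_poly S w \<noteq> 0"
  using step_coeff_nonzero[of 1] by (simp add: step_poly_eq)

text \<open>The kernel is linear in \<open>t\<close>, and its leading coefficient does not vanish at
  an independent point.\<close>

lemma walk_kernel_eq_0_iff:
  assumes "indep u v"
  shows "walk_kernel S w t u v = 0 \<longleftrightarrow> t = eval_ratfun2 (kernel_param S w) u v"
proof -
  interpret field_morphism "\<lambda>A. eval_ratfun2 A u v"
    by (rule field_morphism_eval_ratfun2[OF assms])
  have "eval_ratfun2 (kernel_param S w) u v = u * v / eval_poly2 (step_poly S w) u v"
    by (simp add: kernel_param_def divide mult)
  moreover have "eval_poly2 (step_poly S w) u v \<noteq> 0"
    using assms step_poly_nonzero by (simp add: indepD)
  ultimately show ?thesis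
    unfolding walk_kernel_step_poly by (metis nonzero_eq_divide_eq right_minus_eq)
qed

lemma walk_kernel_param: "walk_kernel S w (kernel_param S w) var1 var2 = 0"
  by (simp add: walk_kernel_eq_0_iff indep_var)

lemma kernel_param_nonzero: "kernel_param S w \<noteq> 0"
  using indep_nonzero[OF indep_var] step_poly_nonzero by (simp add: kernel_param_def)

text \<open>\<Psi> moves the generic point to the other root in \<open>y\<close> for the same
  parameter, and \<open>walk_kernel_eq_0_iff\<close> reads the parameter off any generic point of
  the curve.\<close>

lemma kernel_param_Psi: "subst_ratfun2 (kernel_param S w) (step_Psi S w) = kernel_param S w"
proof -
  have "snd (step_Psi S w) \<in> {y. walk_kernel S w (kernel_param S w) var1 y = 0}"
    unfolding y_root_set(2)[OF indep_var kernel_param_nonzero walk_kernel_param]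
    by (simp add: step_Psi_def)
  then have "walk_kernel S w (kernel_param S w) (fst (step_Psi S w)) (snd (step_Psi S w)) = 0"
    by (simp add: step_Psi_def)
  then show ?thesis
    by (simp add: walk_kernel_eq_0_iff[OF indep_step_Psi] subst_ratfun2_def)
qed

lemma kernel_param_Phi: "subst_ratfun2 (kernel_param S w) (step_Phi S w) = kernel_param S w"
proof -
  have "fst (step_Phi S w) \<in> {x. walk_kernel S w (kernel_param S w) x var2 = 0}"
    unfolding x_root_set[OF indep_var kernel_param_nonzero walk_kernel_param]
    by (simp add: step_Phi_def)
  then have "walk_kernel S w (kernel_param S w) (fst (step_Phi S w)) (snd (step_Phi S w)) = 0"
    by (simp add: step_Phi_def)
  then show ?thesis
    by (simp add: walk_kernel_eq_0_iff[OF indep_step_Phi] subst_ratfun2_def)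
qed

lemma kernel_param_invariant:
  assumes "\<gamma> \<in> carrier (step_group S w)"
  shows "subst_ratfun2 (kernel_param S w) \<gamma> = kernel_param S w"
proof -
  interpret dihedral "step_group S w" "step_Phi S w" "step_Psi S w"
    by (rule dihedral_step_group)
  have sub: "generate (step_group S w) {step_Phi S w, step_Psi S w} \<subseteq> carrier (step_group S w)"
    using generated by simp
  have "\<gamma> \<in> generate (step_group S w) {step_Phi S w, step_Psi S w}"
    using assms generated by simp
  then show ?thesis
  proof induction
    case one
    show ?case by simp
  next
    case (incl \<gamma>)
    then show ?case using kernel_param_Phi kernel_param_Psi by auto
  next
    case (inv \<gamma>)
    have "inv\<^bsub>step_group S w\<^esub> step_Phi S w = step_Phi S w" "inv\<^bsub>step_group S w\<^esub> step_Psi S w = step_Psi S w"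
      using aa bb by (auto intro!: inv_equality)
    with inv show ?case using kernel_param_Phi kernel_param_Psi by auto
  next
    case (eng \<gamma> \<delta>)
    then have "indep (fst \<delta>) (snd \<delta>)" using sub carrier_step_group by blast
    with eng show ?case by (simp only: step_group_mult subst_mult)
  qed
qed

lemma ex_y_root: "\<exists>y. walk_kernel S w ind_t ind_z y = 0"
proof -
  let ?p = "[:ind_t * coeff_y S w (-1) ind_z, ind_t * coeff_y S w 0 ind_z - ind_z, ind_t * coeff_y S w 1 ind_z:]"
  have "ind_t * coeff_y S w 1 ind_z \<noteq> 0"
    using coeff_y_nonzero[OF indep_ind] indep_nonzero[OF indep_ind] by simp
  then have "degree ?p > 0" by simp
  then obtain y where "poly ?p y = 0"
    using alg_closed_imp_poly_has_root by blast
  then show ?thesis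
    by (auto simp: walk_kernel_eq_quadratic(2)[OF model] algebra_simps power2_eq_square)
qed

lemma ex_x_root: "\<exists>x. walk_kernel S w ind_t x ind_z = 0"
  using small_step.ex_y_root[OF transpose] by (simp add: walk_kernel_transpose)

text \<open>Evaluation at a point \<open>(ind_z, y)\<close> of the curve embeds the field of
  rational functions and sends \<open>var1\<close> and the parameter to the independent pair
  \<open>ind_z\<close>, \<open>ind_t\<close>.\<close>

lemma indep_var1_param: "indep var1 (kernel_param S w)"
proof -
  obtain y where y: "walk_kernel S w ind_t ind_z y = 0" using ex_y_root by blast
  have zy: "indep ind_z y" by (rule indep_y_root[OF indep_ind y])
  then show ?thesis
    using field_morphism_indep_iff[OF field_morphism_eval_ratfun2[OF zy], of var1 "kernel_param S w"]
      walk_kernel_eq_0_iff[OF zy] y indep_ind by auto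
qed

lemma indep_var2_param: "indep var2 (kernel_param S w)"
proof -
  obtain x where x: "walk_kernel S w ind_t x ind_z = 0" using ex_x_root by blast
  have xz: "indep x ind_z" by (rule indep_x_root[OF indep_ind x])
  then show ?thesis
    using field_morphism_indep_iff[OF field_morphism_eval_ratfun2[OF xz], of var2 "kernel_param S w"]
      walk_kernel_eq_0_iff[OF xz] x indep_ind by auto
qed

lemma indep_coordinates_param:
  assumes "\<gamma> \<in> carrier (step_group S w)"
  shows "indep (fst \<gamma>) (kernel_param S w)" "indep (snd \<gamma>) (kernel_param S w)"
proof -
  have \<gamma>: "field_morphism (\<lambda>A. subst_ratfun2 A \<gamma>)"
    by (rule field_morphism_subst[OF carrier_step_group[OF assms]])
  have "subst_ratfun2 var1 \<gamma> = fst \<gamma>" "subst_ratfun2 var2 \<gamma> = snd \<gamma>"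
    by (simp_all add: subst_ratfun2_def)
  then show "indep (fst \<gamma>) (kernel_param S w)" "indep (snd \<gamma>) (kernel_param S w)"
    using field_morphism_indep_iff[OF \<gamma>, of var1 "kernel_param S w"]
      field_morphism_indep_iff[OF \<gamma>, of var2 "kernel_param S w"]
      kernel_param_invariant[OF assms] indep_var1_param indep_var2_param by auto
qed

end

section \<open>Symmetric functions of the two roots\<close>

lemma quadratic_root_sum:
  fixes a b c y :: "'a::field"
  assumes "a \<noteq> 0" "y \<noteq> 0" "a * y\<^sup>2 + b * y + c = 0"
  shows "y + c / a * (1 / y) = - b / a"
proof -
  have "c = - (a * y\<^sup>2 + b * y)"
    using assms(3) by (metis add.commute eq_neg_iff_add_eq_0)
  then show ?thesis
    using assms(1,2) by (simp add: field_simps power2_eq_square)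
qed

text \<open>The Galois argument for a quadratic extension, done by hand: values at \<open>y0\<close>
  and \<open>y1\<close> have the same coordinates over the range of \<open>h\<close>, so their sum
  lies in that range. The argument also covers a double root.\<close>

lemma quadratic_trace:
  fixes h :: "'a::field_char_0 \<Rightarrow> 'b::field_char_0"
  assumes "field_morphism h" and sum_eq: "y0 + y1 = h s" and prod_eq: "y0 * y1 = h p"
    and indep: "indep (h z) y0" "indep (h z) y1"
  shows "\<exists>F. h F = eval_ratfun2 A (h z) y0 + eval_ratfun2 A (h z) y1"
proof -
  interpret field_morphism h by fact
  \<comment> \<open>\<open>C a b\<close> says that \<open>a\<close> and \<open>b\<close> are
    conjugate: the same linear expression, taken at \<open>y0\<close> and at
    \<open>y1\<close>.\<close>
  define C where "C = (\<lambda>a b. \<exists>u v. a = h u + h v * y0 \<and> b = h u + h v * y1)"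
  have CI: "C a b" if "a = h u + h v * y0" "b = h u + h v * y1" for a b u v
    using that by (auto simp: C_def)
  have sq: "y0 * y0 = h s * y0 - h p" "y1 * y1 = h s * y1 - h p"
    by (simp_all add: algebra_simps flip: sum_eq prod_eq)
  have C_add: "C (a + a') (b + b')" if "C a b" "C a' b'" for a b a' b'
  proof -
    from that obtain u v u' v' where "a = h u + h v * y0" "b = h u + h v * y1"
      "a' = h u' + h v' * y0" "b' = h u' + h v' * y1" by (auto simp: C_def)
    then show ?thesis
      by (intro CI[of _ "u + u'" "v + v'"]) (simp_all add: add algebra_simps)
  qed
  have C_mult: "C (a * a') (b * b')" if "C a b" "C a' b'" for a b a' b'
  proof -
    from that obtain u v u' v' where *: "a = h u + h v * y0" "b = h u + h v * y1"
      "a' = h u' + h v' * y0" "b' = h u' + h v' * y1" by (auto simp: C_def)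
    have "(h u + h v * y) * (h u' + h v' * y)
        = h (u * u' - v * v' * p) + h (u * v' + u' * v + v * v' * s) * y"
      if "y * y = h s * y - h p" for y
    proof -
      have "(h u + h v * y) * (h u' + h v' * y)
          = h u * h u' + (h u * h v' + h u' * h v) * y + h v * h v' * (y * y)"
        by (simp add: algebra_simps)
      then show ?thesis unfolding that by (simp add: add mult diff algebra_simps)
    qed
    from this[OF sq(1)] this[OF sq(2)] show ?thesis unfolding * by (rule CI)
  qed
  have C_inverse: "C (inverse a) (inverse b)" if "C a b" "a \<noteq> 0" "b \<noteq> 0" for a b
  proof -
    from that(1) obtain u v where ab: "a = h u + h v * y0" "b = h u + h v * y1"
      by (auto simp: C_def)
    \<comment> \<open>The norm \<open>a * b\<close> in terms of the sum and product of the roots; it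
      lies in the base field, so \<open>inverse a\<close> is \<open>b\<close> divided by it.\<close>
    define N where "N = u * u + u * v * s + v * v * p"
    have "a * b = h u * h u + h u * h v * (y0 + y1) + h v * h v * (y0 * y1)"
      unfolding ab by (simp add: algebra_simps)
    also have "\<dots> = h N" unfolding sum_eq prod_eq by (simp add: N_def add mult)
    finally have N: "a * b = h N" .
    have "C b a"
    proof (rule CI)
      have "h v * h s = h v * y0 + h v * y1"
        unfolding sum_eq[symmetric] by (simp add: algebra_simps)
      then show "b = h (u + v * s) + h (- v) * y0" "a = h (u + v * s) + h (- v) * y1"
        unfolding ab by (simp_all add: add mult uminus algebra_simps)
    qed
    moreover have "C (h (inverse N)) (h (inverse N))"
      by (rule CI[of _ "inverse N" 0]) simp_all
    ultimately have "C (b * h (inverse N)) (a * h (inverse N))" by (rule C_mult)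
    moreover have "b * h (inverse N) = inverse a" "a * h (inverse N) = inverse b"
      unfolding inverse N[symmetric] using that(2,3) by simp_all
    ultimately show ?thesis by simp
  qed
  have C_poly: "C (eval_poly2 P (h z) y0) (eval_poly2 P (h z) y1)" for P
  proof (induction P)
    case 0
    show ?case by (rule CI[of _ 0 0]) simp_all
  next
    case (pCons q P)
    have split: "eval_poly2 (pCons q P) (h z) y
        = h (poly (map_poly of_rat q) z) + y * eval_poly2 P (h z) y" for y
    proof -
      have "pCons q P = [:q:] + [:0, 1:] * P" by simp
      then have "eval_poly2 (pCons q P) (h z) y = eval_poly2 [:q:] (h z) y + y * eval_poly2 P (h z) y"
        by (simp only: eval_poly2_simps eval_poly2_Y)
      moreover have "eval_poly2 [:q:] (h z) y = h (eval_poly2 [:q:] z z)"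
        unfolding eval_poly2 by (simp add: eval_poly2_const)
      ultimately show ?thesis by (simp add: eval_poly2_const)
    qed
    have "C (h c) (h c)" for c by (rule CI[of _ c 0]) simp_all
    moreover have "C y0 y1" by (rule CI[of _ 0 1]) simp_all
    ultimately show ?case
      unfolding split using pCons.IH by (intro C_add C_mult)
  qed
  obtain P Q where A: "A = to_fract P / to_fract Q" "Q \<noteq> 0" by (rule ratfun2_cases)
  have "C (eval_poly2 P (h z) y0 * inverse (eval_poly2 Q (h z) y0))
      (eval_poly2 P (h z) y1 * inverse (eval_poly2 Q (h z) y1))"
    using A(2) indep by (intro C_mult C_inverse C_poly) (simp_all add: indepD)
  then have "C (eval_ratfun2 A (h z) y0) (eval_ratfun2 A (h z) y1)"
    unfolding divide_inverse[symmetric] A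
      eval_ratfun2_fraction[OF indep(1) A(2)] eval_ratfun2_fraction[OF indep(2) A(2)] .
  then obtain u v where uv: "eval_ratfun2 A (h z) y0 = h u + h v * y0"
    "eval_ratfun2 A (h z) y1 = h u + h v * y1"
    by (auto simp: C_def)
  \<comment> \<open>The sum of the conjugates \<open>u + v y0\<close> and \<open>u + v y1\<close> is
    \<open>2u + v s\<close>.\<close>
  have "h (u + u + v * s) = h u + h u + h v * h s"
    by (simp only: add mult)
  also have "\<dots> = eval_ratfun2 A (h z) y0 + eval_ratfun2 A (h z) y1"
    unfolding uv sum_eq[symmetric] by (simp add: distrib_left)
  finally show ?thesis by blast
qed

context small_step
begin

text \<open>Everything is expressed at the single generic point \<open>(ind_z, Y0)\<close>: passing
  to \<open>Y1\<close> amounts to substituting \<Psi> first.\<close>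

lemma eval_at_other_y_root:
  assumes "y_roots S w ind_z Y0 Y1"
  shows "indep ind_z Y0" "indep ind_z Y1" "ind_t = eval_ratfun2 (kernel_param S w) ind_z Y0"
    "eval_ratfun2 A ind_z Y1 = eval_ratfun2 (subst_ratfun2 A (step_Psi S w)) ind_z Y0"
proof -
  have roots: "{y. walk_kernel S w ind_t ind_z y = 0} = {Y0, Y1}"
    using assms by (simp add: y_roots_def)
  then have Y: "walk_kernel S w ind_t ind_z Y0 = 0" "walk_kernel S w ind_t ind_z Y1 = 0"
    by auto
  show I: "indep ind_z Y0" "indep ind_z Y1"
    using Y by (auto intro: indep_y_root[OF indep_ind])
  show "ind_t = eval_ratfun2 (kernel_param S w) ind_z Y0"
    using Y(1) walk_kernel_eq_0_iff[OF I(1)] by simp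
  have "{Y0, Y1} = {Y0, coeff_y S w (-1) ind_z / coeff_y S w 1 ind_z * (1 / Y0)}"
    using y_root_set(2)[OF indep_ind _ Y(1)] indep_nonzero[OF indep_ind] roots by simp
  then have "Y1 = coeff_y S w (-1) ind_z / coeff_y S w 1 ind_z * (1 / Y0)"
    by (metis doubleton_eq_iff)
  then show "eval_ratfun2 A ind_z Y1 = eval_ratfun2 (subst_ratfun2 A (step_Psi S w)) ind_z Y0"
    by (simp only: eval_subst[OF I(1)] eval_step_Psi[OF I(1)])
qed

lemma eval_at_other_x_root:
  assumes "x_roots S w ind_z X0 X1"
  shows "indep X0 ind_z" "indep X1 ind_z" "ind_t = eval_ratfun2 (kernel_param S w) X0 ind_z"
    "eval_ratfun2 A X1 ind_z = eval_ratfun2 (subst_ratfun2 A (step_Phi S w)) X0 ind_z"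
proof -
  have roots: "{x. walk_kernel S w ind_t x ind_z = 0} = {X0, X1}"
    using assms by (simp add: x_roots_def)
  then have X: "walk_kernel S w ind_t X0 ind_z = 0" "walk_kernel S w ind_t X1 ind_z = 0"
    by auto
  show I: "indep X0 ind_z" "indep X1 ind_z"
    using X by (auto intro: indep_x_root[OF indep_ind])
  show "ind_t = eval_ratfun2 (kernel_param S w) X0 ind_z"
    using X(1) walk_kernel_eq_0_iff[OF I(1)] by simp
  have "{X0, X1} = {X0, coeff_x S w (-1) ind_z / coeff_x S w 1 ind_z * (1 / X0)}"
    using x_root_set[OF indep_swap[OF indep_ind] _ X(1)] indep_nonzero[OF indep_ind] roots by simp
  then have "X1 = coeff_x S w (-1) ind_z / coeff_x S w 1 ind_z * (1 / X0)"
    by (metis doubleton_eq_iff)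
  then show "eval_ratfun2 A X1 ind_z = eval_ratfun2 (subst_ratfun2 A (step_Phi S w)) X0 ind_z"
    by (simp only: eval_subst[OF I(1)] eval_step_Phi[OF I(1)])
qed

lemma ex_y_roots: "\<exists>Y0 Y1. y_roots S w ind_z Y0 Y1"
  using ex_y_root y_root_set(2)[OF indep_ind] indep_nonzero[OF indep_ind]
  unfolding y_roots_def by metis

lemma ex_x_roots: "\<exists>X0 X1. x_roots S w ind_z X0 X1"
  using ex_x_root x_root_set[OF indep_swap[OF indep_ind]] indep_nonzero[OF indep_ind]
  unfolding x_roots_def by metis

text \<open>By Vieta the sum and product of the roots come from rational functions of
  \<open>ind_z\<close> and \<open>ind_t\<close>, which is what \<open>quadratic_trace\<close>
  requires.\<close>

lemma trace_y_roots:
  "\<exists>F. \<forall>Y0 Y1. y_roots S w ind_z Y0 Y1 \<longrightarrow>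
     eval_ratfun2 F ind_z ind_t = eval_ratfun2 A ind_z Y0 + eval_ratfun2 A ind_z Y1"
proof -
  obtain Y0 Y1 where Y: "y_roots S w ind_z Y0 Y1" using ex_y_roots by blast
  have roots: "{y. walk_kernel S w ind_t ind_z y = 0} = {Y0, Y1}"
    using Y by (simp add: y_roots_def)
  then have K: "walk_kernel S w ind_t ind_z Y0 = 0" by auto
  have nz: "ind_t \<noteq> 0" "coeff_y S w 1 ind_z \<noteq> 0"
    using indep_nonzero[OF indep_ind] coeff_y_nonzero[OF indep_ind] by simp_all
  have Y0: "Y0 \<noteq> 0" using indep_nonzero[OF eval_at_other_y_root(1)[OF Y]] by simp
  have "{Y0, Y1} = {Y0, coeff_y S w (-1) ind_z / coeff_y S w 1 ind_z * (1 / Y0)}"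
    using y_root_set(2)[OF indep_ind nz(1) K] roots by simp
  then have Y1: "Y1 = coeff_y S w (-1) ind_z / coeff_y S w 1 ind_z * (1 / Y0)"
    by (metis doubleton_eq_iff)
  interpret field_morphism "to_ac :: ratfun2 \<Rightarrow> curve_field" by (rule field_morphism_to_ac)
  have "Y0 + (ind_t * coeff_y S w (-1) ind_z) / (ind_t * coeff_y S w 1 ind_z) * (1 / Y0)
      = - (ind_t * coeff_y S w 0 ind_z - ind_z) / (ind_t * coeff_y S w 1 ind_z)"
    using K nz Y0 unfolding walk_kernel_eq_quadratic(2)[OF model]
    by (intro quadratic_root_sum) simp_all
  then have "Y0 + Y1 = - (ind_t * coeff_y S w 0 ind_z - ind_z) / (ind_t * coeff_y S w 1 ind_z)"
    unfolding Y1 using nz by simp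
  also have "\<dots> = to_ac (- (var2 * coeff_y S w 0 var1 - var1) / (var2 * coeff_y S w 1 var1))"
    by (simp add: ind_z_def ind_t_def coeff_y)
  finally have sum: "Y0 + Y1 = to_ac (- (var2 * coeff_y S w 0 var1 - var1) / (var2 * coeff_y S w 1 var1))" .
  have prod: "Y0 * Y1 = to_ac (coeff_y S w (-1) var1 / coeff_y S w 1 var1)"
    unfolding Y1 using Y0 by (simp add: ind_z_def coeff_y)
  obtain F where F: "to_ac F = eval_ratfun2 A ind_z Y0 + eval_ratfun2 A ind_z Y1"
    using quadratic_trace[OF field_morphism_to_ac sum prod, of var1 A]
      eval_at_other_y_root(1,2)[OF Y] unfolding ind_z_def by blast
  \<comment> \<open>\<open>F\<close> was built from one labelling of the roots; the sum is
    symmetric, so any labelling gives the same value.\<close>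
  have "eval_ratfun2 F ind_z ind_t = eval_ratfun2 A ind_z Y0' + eval_ratfun2 A ind_z Y1'"
    if "y_roots S w ind_z Y0' Y1'" for Y0' Y1'
  proof -
    have "{Y0', Y1'} = {Y0, Y1}" using that roots by (simp add: y_roots_def)
    then show ?thesis by (auto simp: eval_ratfun2_ind F doubleton_eq_iff)
  qed
  then show ?thesis by blast
qed

lemma trace_x_roots:
  "\<exists>G. \<forall>X0 X1. x_roots S w ind_z X0 X1 \<longrightarrow>
     eval_ratfun2 G ind_z ind_t = eval_ratfun2 A X0 ind_z + eval_ratfun2 A X1 ind_z"
proof -
  obtain G where G: "\<And>X0 X1. y_roots (transpose_steps S) (transpose_weights w) ind_z X0 X1 \<Longrightarrow>
      eval_ratfun2 G ind_z ind_t = eval_ratfun2 (subst_ratfun2 A swap_map) ind_z X0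
        + eval_ratfun2 (subst_ratfun2 A swap_map) ind_z X1"
    using small_step.trace_y_roots[OF transpose, of "subst_ratfun2 A swap_map"] by blast
  have "eval_ratfun2 G ind_z ind_t = eval_ratfun2 A X0 ind_z + eval_ratfun2 A X1 ind_z"
    if X: "x_roots S w ind_z X0 X1" for X0 X1
    using G[of X0 X1] X eval_at_other_x_root(1,2)[OF X]
    by (simp add: y_roots_def x_roots_def walk_kernel_transpose eval_swap_map indep_swap)
  then show ?thesis by blast
qed

end

section \<open>Specialization of the generic point\<close>

text \<open>Polynomials in \<open>x\<close>, \<open>y\<close>, \<open>t\<close> with
  \<open>t\<close> outermost, so that the kernel becomes linear and Gauss's lemma can be applied
  over the polynomials in \<open>x\<close> and \<open>y\<close>.\<close>

definition eval_poly3 :: "rat poly poly poly \<Rightarrow> 'a::field_char_0 \<Rightarrow> 'a \<Rightarrow> 'a \<Rightarrow> 'a" where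
  "eval_poly3 Q x y t = poly (map_poly (\<lambda>P. eval_poly2 P x y) Q) t"

lemma ring_morphism_eval_poly3: "ring_morphism (\<lambda>Q. eval_poly3 Q x y t)"
  unfolding eval_poly3_def by (rule ring_morphism.ring_morphism_poly[OF ring_morphism_eval_poly2])

lemmas eval_poly3_simps =
  ring_morphism.add[OF ring_morphism_eval_poly3] ring_morphism.mult[OF ring_morphism_eval_poly3]
  ring_morphism.diff[OF ring_morphism_eval_poly3]

text \<open>The three lifts place numerators and denominators of \<open>H\<close>, \<open>F\<close>
  and \<open>G\<close> in one polynomial ring.\<close>

definition lift_xy :: "rat poly poly \<Rightarrow> rat poly poly poly" where
  "lift_xy P = [:P:]"

definition lift_xt :: "rat poly poly \<Rightarrow> rat poly poly poly" where
  "lift_xt P = map_poly (\<lambda>p. [:p:]) P"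

definition lift_yt :: "rat poly poly \<Rightarrow> rat poly poly poly" where
  "lift_yt P = map_poly (map_poly (\<lambda>c. [:c:])) P"

lemma eval_lift_xy: "eval_poly3 (lift_xy P) x y t = eval_poly2 P x y"
  by (simp add: eval_poly3_def lift_xy_def ring_morphism.map_poly_pCons[OF ring_morphism_eval_poly2])

lemma eval_lift_xt: "eval_poly3 (lift_xt P) x y t = eval_poly2 P x t"
  by (simp add: eval_poly3_def lift_xt_def map_poly_map_poly comp_def eval_poly2_const)
     (simp add: eval_poly2_def)

lemma eval_lift_yt: "eval_poly3 (lift_yt P) x y t = eval_poly2 P y t"
  by (simp add: eval_poly2_map_const eval_poly3_def lift_yt_def map_poly_map_poly comp_def)
     (simp add: eval_poly2_def)

context small_step
begin

definition kernel_poly :: "rat poly poly poly" where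
  "kernel_poly = [:- ([:[:0, 1:]:] * [:0, 1:]), step_poly S w:]"

lemma eval_kernel_poly: "eval_poly3 kernel_poly x y t = walk_kernel S w t x y"
proof -
  have "eval_poly3 kernel_poly x y t
      = - eval_poly2 ([:[:0, 1:]:] * [:0, 1:]) x y + t * eval_poly2 (step_poly S w) x y"
    unfolding eval_poly3_def kernel_poly_def
    by (simp only: ring_morphism.map_poly_pCons[OF ring_morphism_eval_poly2] map_poly_0 poly_pCons
        poly_0 eval_poly2_simps) simp
  then show ?thesis
    unfolding walk_kernel_step_poly by (simp only: eval_poly2_simps eval_poly2_X eval_poly2_Y) simp
qed

text \<open>The kernel is linear in \<open>t\<close> with coprime coefficients: \<open>x\<close> divides \<open>step_poly\<close> only if there
  is no step to the left, and \<open>y\<close> divides it only if there is no step down.\<close>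

lemma content_kernel_poly: "content kernel_poly = 1"
proof -
  have x: "prime_elem [:[:0, 1:] :: rat poly:]"
    by (intro lift_prime_elem_poly prime_elem_linear_field_poly) simp
  have y: "prime_elem [:0, 1 :: rat poly:]"
    by (rule prime_elem_linear_poly) simp_all
  have "\<not> [:0, 1:] dvd step_poly S w"
    using step_coeff_nonzero[of "-1"] poly_eq_0_iff_dvd[of "step_poly S w" 0]
    by (simp add: step_poly_eq)
  then have "coprime [:0, 1:] (step_poly S w)"
    using y by (simp add: prime_elem_imp_coprime)
  moreover have "\<not> [:[:0, 1:]:] dvd step_poly S w"
  proof
    assume "[:[:0, 1:]:] dvd step_poly S w"
    then have *: "[:0, 1:] dvd coeff (step_poly S w) k" for k
      by (simp add: const_poly_dvd_iff)
    \<comment> \<open>If \<open>x\<close> divided every coefficient, all constant terms would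
      vanish; a step to the left contributes its weight exactly there, since
      \<open>nat (-1 + 1) = 0\<close>.\<close>
    have c0: "coeff (step_coeff S w j) 0 = 0" if "j \<in> {-1, 0, 1}" for j
      using that *[of 0] *[of 1] *[of 2] poly_eq_0_iff_dvd[of "step_coeff S w j" 0]
      by (auto simp: step_poly_eq poly_0_coeff_0 numeral_2_eq_2)
    obtain j where j: "(-1, j) \<in> S" using steps(2) by blast
    then have "j \<in> {-1, 0, 1}" using S_sub by blast
    then show False
      using c0[of j] coeff_step_coeff[OF j] w_nonzero[OF j] by simp
  qed
  then have "coprime [:[:0, 1:]:] (step_poly S w)"
    using x by (simp add: prime_elem_imp_coprime)
  ultimately have "coprime ([:[:0, 1:]:] * [:0, 1:]) (step_poly S w)"
    by (simp only: coprime_mult_left_iff)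
  then have cop: "is_unit c" if "c dvd - ([:[:0, 1:]:] * [:0, 1:])" "c dvd step_poly S w" for c
    using that unfolding dvd_minus_iff by (rule coprime_common_divisor)
  have "content kernel_poly dvd coeff kernel_poly 0" "content kernel_poly dvd coeff kernel_poly 1"
    by simp_all
  then have "is_unit (content kernel_poly)"
    by (intro cop) (simp_all only: kernel_poly_def coeff_pCons_0 coeff_pCons_Suc One_nat_def)
  then show ?thesis by (metis is_unit_normalize normalize_content)
qed

text \<open>Vanishing at the parameter gives divisibility by a linear factor over the fraction
  field. The kernel is a nonzero multiple of that factor and has content 1, so by Gauss's lemma the
  quotient is again a polynomial.\<close>

lemma kernel_poly_dvd:
  assumes "eval_poly3 Q var1 var2 (kernel_param S w) = 0"
  shows "kernel_poly dvd Q"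
proof (rule fract_poly_dvdD[OF _ content_kernel_poly])
  let ?T = "kernel_param S w"
  have "poly (fract_poly Q) ?T = 0"
    using assms by (simp add: eval_poly3_def)
  then have "[:- ?T, 1:] dvd fract_poly Q"
    by (simp add: poly_eq_0_iff_dvd)
  moreover have *: "fract_poly kernel_poly = smult (to_fract (step_poly S w)) [:- ?T, 1:]"
  proof -
    define m :: "rat poly poly" where "m = [:[:0, 1:]:] * [:0, 1:]"
    have "to_fract m = var1 * var2"
      by (simp only: m_def var1_def var2_def to_fract_mult)
    then have "to_fract (step_poly S w) * ?T = to_fract m"
      using step_poly_nonzero by (simp add: kernel_param_def)
    then show ?thesis
      unfolding kernel_poly_def m_def[symmetric]
      using step_poly_nonzero by (simp add: map_poly_pCons)
  qed
  ultimately show "fract_poly kernel_poly dvd fract_poly Q"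
    using step_poly_nonzero
    by (simp only: * smult_dvd_iff to_fract_eq_0_iff if_False)
qed

lemma frac_eq_sum_iff:
  fixes a b c d e f :: "'a::field"
  assumes "b \<noteq> 0" "d \<noteq> 0" "f \<noteq> 0"
  shows "a / b = c / d + e / f \<longleftrightarrow> a * (d * f) - b * (c * f + d * e) = 0"
  using assms by (simp add: add_frac_eq frac_eq_eq algebra_simps)

text \<open>Clearing denominators yields a polynomial that vanishes at the generic point, hence is a
  multiple of the kernel and vanishes on the whole curve. Regularity at the given point allows
  division by the denominators again.\<close>

lemma decoupled_byI:
  assumes H: "H = eval_ratfun2 F var1 (kernel_param S w) + eval_ratfun2 G var2 (kernel_param S w)"
  shows "decoupled_by S w H F G"
  unfolding decoupled_by_def
proof (intro allI impI)
  fix x y :: curve_field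
  assume K: "walk_kernel S w ind_t x y = 0"
    and reg: "regular_at H x y" "regular_at F x ind_t" "regular_at G y ind_t"
  obtain h1 h2 where h: "quot_of_fract H = (h1, h2)" by (cases "quot_of_fract H")
  obtain f1 f2 where f: "quot_of_fract F = (f1, f2)" by (cases "quot_of_fract F")
  obtain g1 g2 where g: "quot_of_fract G = (g1, g2)" by (cases "quot_of_fract G")
  define Q where "Q = lift_xy h1 * (lift_xt f2 * lift_yt g2)
      - lift_xy h2 * (lift_xt f1 * lift_yt g2 + lift_xt f2 * lift_yt g1)"
  have evQ: "eval_poly3 Q x y t = eval_poly2 h1 x y * (eval_poly2 f2 x t * eval_poly2 g2 y t)
      - eval_poly2 h2 x y * (eval_poly2 f1 x t * eval_poly2 g2 y t + eval_poly2 f2 x t * eval_poly2 g1 y t)"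
    for x y t :: "'a::field_char_0"
    by (simp add: Q_def eval_poly3_simps eval_lift_xy eval_lift_xt eval_lift_yt)
  let ?T = "kernel_param S w"
  have "regular_at H var1 var2" "regular_at F var1 ?T" "regular_at G var2 ?T"
    using indep_regular indep_var indep_var1_param indep_var2_param by blast+
  moreover have "eval_ratfun2 H var1 var2 = eval_ratfun2 F var1 ?T + eval_ratfun2 G var2 ?T"
    by (simp flip: H)
  ultimately have "eval_poly3 Q var1 var2 ?T = 0"
    unfolding eval_ratfun2_def regular_at_def h f g fst_conv snd_conv evQ
    by (intro iffD1[OF frac_eq_sum_iff])
  then obtain R where "Q = kernel_poly * R"
    using kernel_poly_dvd by (auto simp: dvd_def)
  then have "eval_poly3 Q x y ind_t = 0"
    by (simp add: eval_poly3_simps eval_kernel_poly K)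
  then show "eval_ratfun2 H x y = eval_ratfun2 F x ind_t + eval_ratfun2 G y ind_t"
    using reg unfolding eval_ratfun2_def regular_at_def h f g fst_conv snd_conv evQ
    by (intro iffD2[OF frac_eq_sum_iff]) simp_all
qed

end

section \<open>The decoupling theorem\<close>

context small_step
begin

lemma subst_group_act:
  assumes "indep (fst \<delta>) (snd \<delta>)" "finite I"
  shows "subst_ratfun2 (group_act A (\<Sum>i\<in>I. Poly_Mapping.single (\<gamma> i) (c i))) \<delta>
    = (\<Sum>i\<in>I. of_rat (c i) * subst_ratfun2 A (\<gamma> i \<otimes>\<^bsub>step_group S w\<^esub> \<delta>))"
proof -
  interpret field_morphism "\<lambda>A. subst_ratfun2 A \<delta>"
    by (rule field_morphism_subst[OF assms(1)])
  show ?thesis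
    by (simp add: group_act_sum_single[OF assms(2)] sum mult of_rat subst_mult[OF assms(1)]
        del: mult_ratmap)
qed

lemma group_act_alpha:
  assumes "finite (carrier (step_group S w))"
  shows "group_act H (alpha_elt S w) = (\<Sum>\<gamma>\<in>carrier (step_group S w).
    (if \<exists>k::int. \<gamma> = Theta S w [^]\<^bsub>step_group S w\<^esub> k then 1 else - 1) * subst_ratfun2 H \<gamma>)"
  unfolding alpha_elt_def group_act_sum_single[OF assms]
  by (rule sum.cong) (auto simp: group_sign_def)

text \<open>The decoupling is used at the images of the generic point \<open>(ind_z, Y0)\<close>
  under all group elements. They stay on the curve because the parameter is invariant.\<close>

lemma decoupled_imp_alternating_sum_zero:
  assumes fin: "finite (carrier (step_group S w))" and dec: "decoupled_by S w H F G"
  shows "group_act H (alpha_elt S w) = 0"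
proof -
  interpret D: dihedral "step_group S w" "step_Phi S w" "step_Psi S w"
    by (rule dihedral_step_group)
  obtain Y0 Y1 where "y_roots S w ind_z Y0 Y1" using ex_y_roots by blast
  note Y = eval_at_other_y_root(1,3)[OF this]
  let ?i = "\<lambda>A. eval_ratfun2 A ind_z Y0"
  let ?s = "\<lambda>\<gamma>. if \<exists>k::int. \<gamma> = Theta S w [^]\<^bsub>step_group S w\<^esub> k then 1 else - 1"
  interpret field_morphism ?i by (rule field_morphism_eval_ratfun2[OF Y(1)])
  have i: "field_morphism ?i" by unfold_locales
  have H: "?i (subst_ratfun2 H \<gamma>)
      = eval_ratfun2 F (?i (fst \<gamma>)) ind_t + eval_ratfun2 G (?i (snd \<gamma>)) ind_t"
    if \<gamma>: "\<gamma> \<in> carrier (step_group S w)" for \<gamma>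
  proof -
    have I: "indep (?i (fst \<gamma>)) (?i (snd \<gamma>))"
      using carrier_step_group[OF \<gamma>] by (simp add: field_morphism_indep_iff[OF i])
    have "ind_t = ?i (subst_ratfun2 (kernel_param S w) \<gamma>)"
      using Y(2) by (simp add: kernel_param_invariant[OF \<gamma>])
    then have "walk_kernel S w ind_t (?i (fst \<gamma>)) (?i (snd \<gamma>)) = 0"
      by (simp add: walk_kernel_eq_0_iff[OF I] eval_subst[OF Y(1)])
    \<comment> \<open>These independences make \<open>F\<close> and \<open>G\<close> regular at the
      image point, so the decoupling equation really applies there.\<close>
    moreover have "indep (?i (fst \<gamma>)) ind_t" "indep (?i (snd \<gamma>)) ind_t"
      using indep_coordinates_param[OF \<gamma>] unfolding Y(2) by (simp_all add: field_morphism_indep_iff[OF i])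
    ultimately show ?thesis
      using dec I unfolding decoupled_by_def eval_subst[OF Y(1)] by (blast intro: indep_regular)
  qed
  have "?i (group_act H (alpha_elt S w))
      = (\<Sum>\<gamma>\<in>carrier (step_group S w). ?s \<gamma> * ?i (subst_ratfun2 H \<gamma>))"
    unfolding group_act_alpha[OF fin] sum
    by (rule sum.cong) (auto simp: mult uminus)
  also have "\<dots> = (\<Sum>\<gamma>\<in>carrier (step_group S w). ?s \<gamma> * eval_ratfun2 F (?i (fst \<gamma>)) ind_t)
      + (\<Sum>\<gamma>\<in>carrier (step_group S w). ?s \<gamma> * eval_ratfun2 G (?i (snd \<gamma>)) ind_t)"
    by (simp only: H distrib_left sum.distrib cong: sum.cong)
  \<comment> \<open>Left multiplication by \<Psi> keeps the first coordinate of \<gamma>; for the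
    sum over \<open>G\<close>, \<Phi> keeps the second.\<close>
  also have "(\<Sum>\<gamma>\<in>carrier (step_group S w). ?s \<gamma> * eval_ratfun2 F (?i (fst \<gamma>)) ind_t) = 0"
    unfolding Theta_def
    by (rule D.alternating_sum_zero[of "step_Psi S w"]) (simp_all add: step_Psi_def subst_ratfun2_def)
  also have "(\<Sum>\<gamma>\<in>carrier (step_group S w). ?s \<gamma> * eval_ratfun2 G (?i (snd \<gamma>)) ind_t) = 0"
    unfolding Theta_def
    by (rule D.alternating_sum_zero[of "step_Phi S w"]) (simp_all add: step_Phi_def subst_ratfun2_def)
  finally show ?thesis by simp
qed

text \<open>The group identity applied to \<open>H\<close> splits it into a part symmetric under
  \<Psi> and a part symmetric under \<Phi>; traces over the roots turn these into functions of
  \<open>x\<close> and \<open>t\<close>, and of \<open>y\<close> and \<open>t\<close>.\<close>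

lemma alternating_sum_zero_imp_decoupled:
  assumes fin: "finite (carrier (step_group S w))" and order: "Coset.order (step_group S w) = 2 * n"
    and zero: "group_act H (alpha_elt S w) = 0"
  shows "\<exists>F G. decoupled_by S w H F G \<and>
    (\<forall>Y0 Y1. y_roots S w ind_z Y0 Y1 \<longrightarrow>
       eval_ratfun2 F ind_z ind_t =
         eval_ratfun2 (group_act H (tau_elt S w n)) ind_z Y0 +
         eval_ratfun2 (group_act H (tau_elt S w n)) ind_z Y1) \<and>
    (\<forall>X0 X1. x_roots S w ind_z X0 X1 \<longrightarrow>
       eval_ratfun2 G ind_z ind_t =
         eval_ratfun2 (group_act H (tau_tilde_elt S w n)) X0 ind_z +
         eval_ratfun2 (group_act H (tau_tilde_elt S w n)) X1 ind_z +
         (1 - 1 / (2 * of_nat n)) * eval_ratfun2 (group_act H (sigma_elt S w)) X0 ind_z)"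
proof -
  interpret D: dihedral "step_group S w" "step_Phi S w" "step_Psi S w"
    by (rule dihedral_step_group)
  let ?T = "kernel_param S w"
  define A where "A = group_act H (tau_elt S w n)"
  define B where "B = group_act H (tau_tilde_elt S w n)"
  define J where "J = group_act H (sigma_elt S w)"
  let ?c = "\<lambda>i. - (of_nat i / of_nat n) :: ratfun2"
  have c: "of_rat (- (1 / of_nat n) * of_nat i) = ?c i" for i
    by (simp add: of_rat_mult of_rat_minus of_rat_divide)
  have A: "A + subst_ratfun2 A (step_Psi S w)
      = (\<Sum>i\<in>{1..<n}. ?c i * (subst_ratfun2 H (Theta S w [^]\<^bsub>step_group S w\<^esub> int i)
          + subst_ratfun2 H (Theta S w [^]\<^bsub>step_group S w\<^esub> int i \<otimes>\<^bsub>step_group S w\<^esub> step_Psi S w)))"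
    unfolding A_def tau_elt_def subst_group_act[OF indep_step_Psi finite_atLeastLessThan]
    unfolding group_act_sum_single[OF finite_atLeastLessThan] c distrib_left sum.distrib ..
  have B: "B + subst_ratfun2 B (step_Phi S w)
      = (\<Sum>i\<in>{1..<n}. ?c i * (subst_ratfun2 H (Theta S w [^]\<^bsub>step_group S w\<^esub> (- int i))
          + subst_ratfun2 H (Theta S w [^]\<^bsub>step_group S w\<^esub> (- int i) \<otimes>\<^bsub>step_group S w\<^esub> step_Phi S w)))"
    unfolding B_def tau_tilde_elt_def subst_group_act[OF indep_step_Phi finite_atLeastLessThan]
    unfolding group_act_sum_single[OF finite_atLeastLessThan] c distrib_left sum.distrib ..
  have J: "J = (\<Sum>\<gamma>\<in>carrier (step_group S w). subst_ratfun2 H \<gamma>)"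
    by (simp add: J_def sigma_elt_def group_act_sum_single[OF fin])
  \<comment> \<open>Right multiplication by \<Phi> only permutes the group, so \<open>J\<close>
    takes the same value at both roots in \<open>x\<close>.\<close>
  have J_Phi: "subst_ratfun2 J (step_Phi S w) = J"
  proof -
    have "subst_ratfun2 J (step_Phi S w)
        = (\<Sum>\<gamma>\<in>carrier (step_group S w). subst_ratfun2 H (\<gamma> \<otimes>\<^bsub>step_group S w\<^esub> step_Phi S w))"
      unfolding J_def sigma_elt_def subst_group_act[OF indep_step_Phi fin] by simp
    also have "\<dots> = (\<Sum>\<gamma>\<in>carrier (step_group S w). subst_ratfun2 H \<gamma>)"
      by (rule sum.reindex_bij_witness[of _ "\<lambda>\<gamma>. \<gamma> \<otimes>\<^bsub>step_group S w\<^esub> step_Phi S w"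
            "\<lambda>\<gamma>. \<gamma> \<otimes>\<^bsub>step_group S w\<^esub> step_Phi S w"])
         (simp_all add: D.m_assoc D.aa del: step_group_mult step_group_one)
    finally show ?thesis by (simp add: J)
  qed
  have "(A + subst_ratfun2 A (step_Psi S w)) + (B + subst_ratfun2 B (step_Phi S w))
      + (1 - 1 / (2 * of_nat n)) * J + 1 / (2 * of_nat n) * group_act H (alpha_elt S w)
      = subst_ratfun2 H \<one>\<^bsub>step_group S w\<^esub>"
    unfolding A B J group_act_alpha[OF fin] Theta_def by (rule D.decoupling_identity[OF fin order])
  then have identity: "H = (A + subst_ratfun2 A (step_Psi S w)) + (B + subst_ratfun2 B (step_Phi S w))
      + (1 - 1 / (2 * of_nat n)) * J"
    by (simp add: zero)
  obtain F where F: "\<And>Y0 Y1. y_roots S w ind_z Y0 Y1 \<Longrightarrow>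
      eval_ratfun2 F ind_z ind_t = eval_ratfun2 A ind_z Y0 + eval_ratfun2 A ind_z Y1"
    using trace_y_roots[of A] by blast
  obtain G1 where G1: "\<And>X0 X1. x_roots S w ind_z X0 X1 \<Longrightarrow>
      eval_ratfun2 G1 ind_z ind_t = eval_ratfun2 B X0 ind_z + eval_ratfun2 B X1 ind_z"
    using trace_x_roots[of B] by blast
  obtain G2 where G2: "\<And>X0 X1. x_roots S w ind_z X0 X1 \<Longrightarrow>
      eval_ratfun2 G2 ind_z ind_t = eval_ratfun2 J X0 ind_z + eval_ratfun2 J X1 ind_z"
    using trace_x_roots[of J] by blast
  \<comment> \<open>The trace of \<open>J\<close> counts its common value at the two roots twice,
    hence the division by 2.\<close>
  define G where "G = G1 + (1 - 1 / (2 * of_nat n)) * (G2 / 2)"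
  have G: "eval_ratfun2 G ind_z ind_t = eval_ratfun2 B X0 ind_z + eval_ratfun2 B X1 ind_z
      + (1 - 1 / (2 * of_nat n)) * eval_ratfun2 J X0 ind_z"
    if X: "x_roots S w ind_z X0 X1" for X0 X1
  proof -
    have "eval_ratfun2 J X1 ind_z = eval_ratfun2 J X0 ind_z"
      using eval_at_other_x_root(4)[OF X, of J] by (simp add: J_Phi)
    then show ?thesis
      using G1[OF X] G2[OF X] by (simp add: eval_ratfun2_ind G_def)
  qed
  \<comment> \<open>\<open>F\<close> is known only at \<open>(ind_z, ind_t)\<close>. Evaluation at
    \<open>(ind_z, Y0)\<close> maps \<open>var1\<close> and the parameter to that pair and is
    injective, so the identity can be pulled back to rational functions.\<close>
  have F_curve: "eval_ratfun2 F var1 ?T = A + subst_ratfun2 A (step_Psi S w)"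
  proof -
    obtain Y0 Y1 where Y: "y_roots S w ind_z Y0 Y1" using ex_y_roots by blast
    note Y' = eval_at_other_y_root[OF Y]
    interpret i: field_morphism "\<lambda>A. eval_ratfun2 A ind_z Y0"
      by (rule field_morphism_eval_ratfun2[OF Y'(1)])
    have "eval_ratfun2 (eval_ratfun2 F var1 ?T) ind_z Y0 = eval_ratfun2 F ind_z ind_t"
      by (simp add: i.eval_ratfun2 flip: Y'(3))
    also have "\<dots> = eval_ratfun2 (A + subst_ratfun2 A (step_Psi S w)) ind_z Y0"
      by (simp add: F[OF Y] i.add Y'(4))
    finally show ?thesis by (simp only: i.eq_iff)
  qed
  have G_curve: "eval_ratfun2 G var2 ?T = B + subst_ratfun2 B (step_Phi S w) + (1 - 1 / (2 * of_nat n)) * J"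
  proof -
    obtain X0 X1 where X: "x_roots S w ind_z X0 X1" using ex_x_roots by blast
    note X' = eval_at_other_x_root[OF X]
    interpret i: field_morphism "\<lambda>A. eval_ratfun2 A X0 ind_z"
      by (rule field_morphism_eval_ratfun2[OF X'(1)])
    have "eval_ratfun2 (eval_ratfun2 G var2 ?T) X0 ind_z = eval_ratfun2 G ind_z ind_t"
      by (simp add: i.eval_ratfun2 flip: X'(3))
    also have "\<dots> = eval_ratfun2 (B + subst_ratfun2 B (step_Phi S w) + (1 - 1 / (2 * of_nat n)) * J) X0 ind_z"
      using i.of_nat[of 2] by (simp add: G[OF X] i.add i.mult i.diff i.divide i.of_nat X'(4))
    finally show ?thesis by (simp only: i.eq_iff)
  qed
  have "decoupled_by S w H F G"
    by (rule decoupled_byI) (simp add: F_curve G_curve identity add.assoc[symmetric])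
  with F G show ?thesis
    unfolding A_def B_def J_def by blast
qed

end

theorem theorem4p9:
  fixes S :: "(int \<times> int) set" and w :: "int \<times> int \<Rightarrow> rat" and H :: ratfun2 and n :: nat
  assumes "small_step_model S w"
    and "finite (carrier (step_group S w))"
    and "Coset.order (step_group S w) = 2 * n"
  shows "(decoupled S w H \<longleftrightarrow> group_act H (alpha_elt S w) = 0) \<and>
    (decoupled S w H \<longrightarrow>
      (\<exists>F G. decoupled_by S w H F G \<and>
        (\<forall>Y0 Y1. y_roots S w ind_z Y0 Y1 \<longrightarrow>
           eval_ratfun2 F ind_z ind_t =
             eval_ratfun2 (group_act H (tau_elt S w n)) ind_z Y0 +
             eval_ratfun2 (group_act H (tau_elt S w n)) ind_z Y1) \<and>
        (\<forall>X0 X1. x_roots S w ind_z X0 X1 \<longrightarrow>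
           eval_ratfun2 G ind_z ind_t =
             eval_ratfun2 (group_act H (tau_tilde_elt S w n)) X0 ind_z +
             eval_ratfun2 (group_act H (tau_tilde_elt S w n)) X1 ind_z +
             (1 - 1 / (2 * of_nat n)) * eval_ratfun2 (group_act H (sigma_elt S w)) X0 ind_z)))"
proof -
  interpret small_step S w by unfold_locales (rule assms(1))
  have "group_act H (alpha_elt S w) = 0" if "decoupled S w H"
    using that decoupled_imp_alternating_sum_zero[OF assms(2)] by (auto simp: decoupled_def)
  then show ?thesis
    using alternating_sum_zero_imp_decoupled[OF assms(2,3), of H] unfolding decoupled_def by blast
qed

end
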